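(* Let $n\geq 2$ be an integer and let $x_1,\dots,x_n$ be the coordinates on $\mathbb{C}^n$. The $c(n,4)$-web $\mathcal{W}B_n$ of codimension one in dimension $n$ whose foliations admit as local first integrals the functions $$x_i\quad(1\le i\le n),$$ $$x_i+x_j,\qquad x_j-x_i,\qquad x_i x_j\quad(1\le i<j\le n),$$ $$x_i+x_j+x_k,\qquad x_i^2+x_j^2+x_k^2,\qquad x_i x_j x_k\quad(1\le i<j<k\le n),$$ $$x_i x_j x_k x_m\quad(1\le i<j<k<m\le n)$$ (families requiring more indices than are available being empty) is ordinary and has maximum rank, i.e. its rank is equal to $\pi'\bigl(n,c(n,4)\bigr)$.
   Context: Notation. $c(n,h)=\frac{(n-1+h)!}{(n-1)!\,h!}$ is the dimension of the space of homogeneous polynomials of degree $h$ in $n$ variables over $\mathbb{C}$. For $d>n\geq 2$, $k_0$ is the integer with $c(n,k_0)\le d<c(n,k_0+1)$, and $\pi'(n,d)=\sum_{h=1}^{k_0}\bigl(d-c(n,h)\bigr)$. (For $d=c(n,4)$ one has $k_0=4$.) The number of functions listed in the claim is exactly $c(n,4)$. Webs. A (totally decomposable) $d$-web of codimension one on a complex manifold $M$ of dimension $n$ is given by $d$ holomorphic foliations $\mathcal{F}_1,\dots,\mathcal{F}_d$ of codimension 1, in at least weak general position: at each point of the regular part, at least $n$ of the $d$ foliations have tangent spaces in general position. One replaces $M$ by an open set on which the web is regular. For a web defined by given functions $u_1,\dots,u_d$ on $\mathbb{C}^n$ (so that $\mathcal{F}_i$ is the foliation by level sets of $u_i$), $M$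 is the dense open subset of $\mathbb{C}^n$ where all $du_i$ are nonzero and the hyperplanes $\ker du_i$ are pairwise distinct. Abelian relations and rank. An abelian relation on a connected, simply connected open set $U\subset M$ is a family $(\omega_i)_{1\le i\le d}$ of holomorphic 1-forms on $U$ such that $d\omega_i=0$ for all $i$, $T\mathcal{F}_i\subset\ker\omega_i$ for all $i$, and $\sum_{i=1}^d\omega_i=0$. The rank of the web is the maximum over $m\in M$ of the dimension of the complex vector space of germs of abelian relations at $m$. For an ordinary $d$-web the rank is at most $\pi'(n,d)$; the web is said to have maximum rank if its rank equals $\pi'(n,d)$. Ordinary webs. Let $u_i$ be local first integrals of the $\mathcal{F}_i$ with $du_i$ nowhere zero, in local coordinates $(x_1,\dots,x_n)$. For a multi-index $L=(\ell_1,\dots,\ell_n)$ put $|L|=\sum_\lambda \ell_\lambda$ and $C_i^L=\prod_{\lambda=1}^n\bigl(\partial u_i/\partial x_\lambda\bigr)^{\ell_\lambda}$. For $h\ge 1$ let $P_h=\bigl(C_i^L\bigr)$ be the matrix with $d$ columns indexed by $i\in\{1,\dots,d\}$ and $c(n,h)$ rows indexed by the multi-indices $L$ with $|L|=h$. (The rank of $P_h$ at a point depends neither on the choice of coordinates nor on that of the $u_i$.) The web is called ordinary if there is an analytic subset $S\subset M$ of dimension at most $n-1$ (possibly empty) such that at every point of $M\setminus S$ each matrix $P_h$, $h\ge1$, has maximum rank $\inf\bigl(d,c(n,h)\bigr)$. *)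

theory Defs
  imports "HOL-Analysis.Analysis" "HOL-Library.Function_Algebras" "HOL-Library.Extended_Nat"
begin

section \<open>Numerical data\<close>

text \<open>The division is exact: \<open>cdim n h\<close> is a binomial coefficient.\<close>

definition cdim :: "nat \<Rightarrow> nat \<Rightarrow> nat" where
  "cdim n h = fact (n - 1 + h) div (fact (n - 1) * fact h)"

definition k0 :: "nat \<Rightarrow> nat \<Rightarrow> nat" where
  "k0 n d = (THE k. cdim n k \<le> d \<and> d < cdim n (k + 1))"

text \<open>For \<open>h \<le> k0 n d\<close> one has \<open>cdim n h \<le> d\<close>, so the natural subtraction does not truncate.\<close>

definition pi' :: "nat \<Rightarrow> nat \<Rightarrow> nat" where
  "pi' n d = (\<Sum>h = 1..k0 n d. d - cdim n h)"


section \<open>Holomorphic functions and analytic subsets of \<open>\<complex>\<^sup>n\<close>\<close>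

text \<open>Only used for open \<open>U\<close>: Frechet differentiability with complex-linear derivative.\<close>

definition holo_on :: "(complex ^ 'n \<Rightarrow> complex) \<Rightarrow> (complex ^ 'n) set \<Rightarrow> bool" where
  "holo_on f U \<longleftrightarrow>
     (\<forall>x\<in>U. \<exists>D. (f has_derivative D) (at x) \<and> (\<forall>c v. D (c *s v) = c * D v))"

definition partial :: "(complex ^ 'n \<Rightarrow> complex) \<Rightarrow> 'n \<Rightarrow> complex ^ 'n \<Rightarrow> complex" where
  "partial f l x = deriv (\<lambda>t. f (x + t *s axis l 1)) 0"

definition analytic_subset :: "(complex ^ 'n) set \<Rightarrow> (complex ^ 'n) set \<Rightarrow> bool" where
  "analytic_subset M S \<longleftrightarrow> S \<subseteq> M \<and>
     (\<forall>p\<in>M. \<exists>W F. open W \<and> p \<in> W \<and> W \<subseteq> M \<and> finite F \<and> (\<forall>f\<in>F. holo_on f W) \<and>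
        S \<inter> W = {x \<in> W. \<forall>f\<in>F. f x = 0})"

text \<open>\<open>S\<close> is near \<open>p\<close> a complex submanifold of dimension \<open>k\<close>: some biholomorphic chart
  \<open>\<phi>\<close> with inverse \<open>\<psi>\<close> maps it onto a coordinate subspace.\<close>

definition regular_point :: "(complex ^ 'n) set \<Rightarrow> nat \<Rightarrow> complex ^ 'n \<Rightarrow> bool" where
  "regular_point S k p \<longleftrightarrow> p \<in> S \<and>
     (\<exists>W (\<phi> :: complex ^ 'n \<Rightarrow> complex ^ 'n) (\<psi> :: complex ^ 'n \<Rightarrow> complex ^ 'n) J.
        open W \<and> p \<in> W \<and> open (\<phi> ` W) \<and>
        (\<forall>l. holo_on (\<lambda>x. \<phi> x $ l) W) \<and> (\<forall>l. holo_on (\<lambda>z. \<psi> z $ l) (\<phi> ` W)) \<and>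
        (\<forall>x\<in>W. \<psi> (\<phi> x) = x) \<and>
        card J = k \<and> \<phi> ` (S \<inter> W) = {z \<in> \<phi> ` W. \<forall>l. l \<notin> J \<longrightarrow> z $ l = 0})"

text \<open>The dimension of an analytic set is the largest dimension at its regular points.\<close>

definition dim_at_most :: "(complex ^ 'n) set \<Rightarrow> nat \<Rightarrow> bool" where
  "dim_at_most S m \<longleftrightarrow> (\<forall>p k. regular_point S k p \<longrightarrow> k \<le> m)"


section \<open>Webs of codimension one given by first integrals\<close>

text \<open>A 1-form \<open>\<Sum>\<^sub>l a\<^sub>l dx\<^sub>l\<close> at a point is represented by its vector \<open>a\<close> of coefficients.\<close>

definition form_ker :: "complex ^ 'n \<Rightarrow> (complex ^ 'n) set" where
  "form_ker a = {v. (\<Sum>l\<in>UNIV. a $ l * v $ l) = 0}"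

definition differential :: "(complex ^ 'n \<Rightarrow> complex) \<Rightarrow> complex ^ 'n \<Rightarrow> complex ^ 'n" where
  "differential f x = (\<chi> l. partial f l x)"

definition regular_locus ::
  "'i set \<Rightarrow> ('i \<Rightarrow> complex ^ 'n \<Rightarrow> complex) \<Rightarrow> (complex ^ 'n) set" where
  "regular_locus I u = {x. (\<forall>i\<in>I. differential (u i) x \<noteq> 0) \<and>
     (\<forall>i\<in>I. \<forall>j\<in>I. i \<noteq> j \<longrightarrow> form_ker (differential (u i) x) \<noteq> form_ker (differential (u j) x))}"

text \<open>The web whose foliations are the level sets of the \<open>u i\<close>, \<open>i \<in> I\<close>. The last condition is
  weak general position: \<open>n\<close> hyperplanes in \<open>\<complex>\<^sup>n\<close> are in general position iff they meet only in 0.\<close>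

definition is_web :: "nat \<Rightarrow> 'i set \<Rightarrow> ('i \<Rightarrow> complex ^ 'n \<Rightarrow> complex) \<Rightarrow> bool" where
  "is_web d I u \<longleftrightarrow> finite I \<and> card I = d \<and> (\<forall>i\<in>I. holo_on (u i) UNIV) \<and>
     open (regular_locus I u) \<and> closure (regular_locus I u) = UNIV \<and>
     (\<forall>x\<in>regular_locus I u. \<exists>J\<subseteq>I. card J = CARD('n) \<and>
        (\<Inter>i\<in>J. form_ker (differential (u i) x)) = {0})"


section \<open>Ordinary webs\<close>

global_interpretation cfun: vector_space "\<lambda>(c::complex) (f :: 'a \<Rightarrow> complex) x. c * f x"
  defines cfun_dim = cfun.dim
  by unfold_locales (auto simp: fun_eq_iff algebra_simps)

text \<open>The column of index \<open>i\<close> of the matrix \<open>P\<^sub>h\<close> at \<open>x\<close>, padded with zeros outside the rows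
  \<open>|L| = h\<close>.\<close>

definition P_column ::
  "('i \<Rightarrow> complex ^ 'n \<Rightarrow> complex) \<Rightarrow> nat \<Rightarrow> complex ^ 'n \<Rightarrow> 'i \<Rightarrow> ('n \<Rightarrow> nat) \<Rightarrow> complex" where
  "P_column u h x i = (\<lambda>L. if (\<Sum>l\<in>UNIV. L l) = h
     then (\<Prod>l\<in>UNIV. partial (u i) l x ^ L l) else 0)"

definition P_rank ::
  "'i set \<Rightarrow> ('i \<Rightarrow> complex ^ 'n \<Rightarrow> complex) \<Rightarrow> nat \<Rightarrow> complex ^ 'n \<Rightarrow> nat" where
  "P_rank I u h x = cfun_dim (P_column u h x ` I)"

definition ordinary :: "'i set \<Rightarrow> ('i \<Rightarrow> complex ^ 'n \<Rightarrow> complex) \<Rightarrow> bool" where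
  "ordinary I u \<longleftrightarrow> (\<exists>S. analytic_subset (regular_locus I u) S \<and> dim_at_most S (CARD('n) - 1) \<and>
     (\<forall>x\<in>regular_locus I u - S. \<forall>h\<ge>1. P_rank I u h x = min (card I) (cdim CARD('n) h)))"


section \<open>Abelian relations and rank\<close>

definition abelian_relation ::
  "'i set \<Rightarrow> ('i \<Rightarrow> complex ^ 'n \<Rightarrow> complex) \<Rightarrow> (complex ^ 'n) set \<Rightarrow>
   ('i \<Rightarrow> complex ^ 'n \<Rightarrow> complex ^ 'n) \<Rightarrow> bool" where
  "abelian_relation I u U \<omega> \<longleftrightarrow>
     (\<forall>i\<in>I. \<forall>l. holo_on (\<lambda>x. \<omega> i x $ l) U) \<and>
     (\<forall>i\<in>I. \<forall>x\<in>U. \<forall>k l. partial (\<lambda>y. \<omega> i y $ k) l x = partial (\<lambda>y. \<omega> i y $ l) k x) \<and>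
     (\<forall>i\<in>I. \<forall>x\<in>U. form_ker (differential (u i) x) \<subseteq> form_ker (\<omega> i x)) \<and>
     (\<forall>x\<in>U. (\<Sum>i\<in>I. \<omega> i x) = 0)"

text \<open>\<open>\<omega>\<close> represents a germ of abelian relation at \<open>m\<close>; two representatives define the same germ
  iff they agree, for all \<open>i \<in> I\<close>, on a neighbourhood of \<open>m\<close>.\<close>

definition abelian_germ ::
  "'i set \<Rightarrow> ('i \<Rightarrow> complex ^ 'n \<Rightarrow> complex) \<Rightarrow> complex ^ 'n \<Rightarrow>
   ('i \<Rightarrow> complex ^ 'n \<Rightarrow> complex ^ 'n) \<Rightarrow> bool" where
  "abelian_germ I u m \<omega> \<longleftrightarrow> (\<exists>U. open U \<and> connected U \<and> simply_connected U \<and> m \<in> U \<and>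
     U \<subseteq> regular_locus I u \<and> abelian_relation I u U \<omega>)"

text \<open>Linear independence over \<open>\<complex>\<close> of the germs at \<open>m\<close> of \<open>\<omega> 0, \<dots>, \<omega> (k - 1)\<close>.\<close>

definition independent_germs ::
  "'i set \<Rightarrow> complex ^ 'n \<Rightarrow> nat \<Rightarrow> (nat \<Rightarrow> 'i \<Rightarrow> complex ^ 'n \<Rightarrow> complex ^ 'n) \<Rightarrow> bool" where
  "independent_germs I m k \<omega> \<longleftrightarrow>
     (\<forall>c :: nat \<Rightarrow> complex. (\<forall>\<^sub>F x in nhds m. \<forall>i\<in>I. (\<Sum>j<k. c j *s \<omega> j i x) = 0) \<longrightarrow>
        (\<forall>j<k. c j = 0))"

text \<open>The dimension of the space of germs of abelian relations at \<open>m\<close>, infinity included.\<close>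

definition abelian_dim ::
  "'i set \<Rightarrow> ('i \<Rightarrow> complex ^ 'n \<Rightarrow> complex) \<Rightarrow> complex ^ 'n \<Rightarrow> enat" where
  "abelian_dim I u m = Sup {enat k | k. \<exists>\<omega>. (\<forall>j<k. abelian_germ I u m (\<omega> j)) \<and>
     independent_germs I m k \<omega>}"

text \<open>A finite supremum in \<^typ>\<open>enat\<close> over a nonempty set is attained, i.e. is a maximum.\<close>

definition web_rank :: "'i set \<Rightarrow> ('i \<Rightarrow> complex ^ 'n \<Rightarrow> complex) \<Rightarrow> enat" where
  "web_rank I u = (SUP m\<in>regular_locus I u. abelian_dim I u m)"


section \<open>The web \<open>\<W>B\<^sub>n\<close>\<close>

text \<open>The coordinates of \<open>\<complex>\<^sup>n\<close> are indexed by a finite linearly ordered type with \<open>n\<close> elements.\<close>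

datatype 'n wb_index =
    Coord 'n
  | Add2 'n 'n
  | Diff2 'n 'n
  | Mult2 'n 'n
  | Add3 'n 'n 'n
  | Squares3 'n 'n 'n
  | Mult3 'n 'n 'n
  | Mult4 'n 'n 'n 'n

definition WB_index :: "'n::{finite,linorder} wb_index set" where
  "WB_index =
     {Coord i | i. True} \<union>
     {Add2 i j | i j. i < j} \<union> {Diff2 i j | i j. i < j} \<union> {Mult2 i j | i j. i < j} \<union>
     {Add3 i j k | i j k. i < j \<and> j < k} \<union> {Squares3 i j k | i j k. i < j \<and> j < k} \<union>
     {Mult3 i j k | i j k. i < j \<and> j < k} \<union>
     {Mult4 i j k m | i j k m. i < j \<and> j < k \<and> k < m}"

fun WB :: "'n::finite wb_index \<Rightarrow> complex ^ 'n \<Rightarrow> complex" where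
  "WB (Coord i) = (\<lambda>x. x $ i)"
| "WB (Add2 i j) = (\<lambda>x. x $ i + x $ j)"
| "WB (Diff2 i j) = (\<lambda>x. x $ j - x $ i)"
| "WB (Mult2 i j) = (\<lambda>x. x $ i * x $ j)"
| "WB (Add3 i j k) = (\<lambda>x. x $ i + x $ j + x $ k)"
| "WB (Squares3 i j k) = (\<lambda>x. (x $ i)^2 + (x $ j)^2 + (x $ k)^2)"
| "WB (Mult3 i j k) = (\<lambda>x. x $ i * x $ j * x $ k)"
| "WB (Mult4 i j k m) = (\<lambda>x. x $ i * x $ j * x $ k * x $ m)"

end

(*
  On the regular locus, which is {x_i <> 0, x_i <> x_j, x_i <> - x_j}, the fourth powers of the
  differentials are linearly independent: a relation among them is solved support by support, from
  the four-index functions down to the coordinates, the triples leading to a Vandermonde determinant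
  in x_i, x_j, x_k.  Multiplying test monomials shows that the h-th powers are independent for all
  h >= 4, and explicit subfamilies of size c(n,h) are independent for h = 1, 2, 3; this gives
  ordinarity with empty exceptional set.

  Upper bound: each component of an abelian relation is f(u) du, and the leading Taylor coefficients
  of the f satisfy a relation among powers of the differentials.  Hence a relation is determined by
  the coefficients of orders h - 1 = 0, 1, 2 outside the subfamily of size c(n,h), and these are
  pi'(n, c(n,4)) linear functionals.

  Lower bound: there are as many explicit relations among powers u^k and powers (log u)^k, namely 6
  for each pair, 8 for each triple and 3 for each quadruple of coordinates, e.g.
  log^2(xyz) = log^2(xy) + log^2(xz) + log^2(yz) - log^2 x - log^2 y - log^2 z.
*)

theory Submission
  imports Defs "HOL-Complex_Analysis.Complex_Analysis"
begin

text \<open>The families are dictated by supports: a set of s variables carries binom(3,s-1)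
  functions, that is 1, 3, 3, 1, which is the number of quartic monomials with exactly that support.
  Hence a relation among fourth powers, tested on monomials of decreasing support, breaks into
  square systems of size at most 3. The same count binom(h-1,s-1) for h = 1, 2, 3 dictates the
  subfamily \<open>WB_low h\<close>; it consists of linear functions, so independence there holds at
  every point. The upper bound is proved at every point of the locus, while the lower bound is
  needed at one point only, since the rank is a supremum. The choice of that point is forced by the
  logarithm: principal values add up only for small arguments. So a point with positive increasing
  coordinates is taken, where all functions of the web are positive. Explicit relations are checked
  between functions, before differentiation, where they are algebraic identities in the x_i or in
  the Ln x_i. Their independence is reduced to one foliation at a time, hence to functions of one
  variable.\<close>

no_notation fps_nth (infixl "$" 75)

section \<open>Complex gradients\<close>

text \<open>The pairing is bilinear, without conjugation: complex linearity of the derivative is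
  built in, and \<open>G\<close> is the coefficient vector of a 1-form.\<close>

definition has_grad :: "(complex ^ 'n \<Rightarrow> complex) \<Rightarrow> complex ^ 'n \<Rightarrow> complex ^ 'n \<Rightarrow> bool" where
  "has_grad f G x \<longleftrightarrow> (f has_derivative (\<lambda>v. \<Sum>l\<in>UNIV. G $ l * v $ l)) (at x)"

lemma has_grad_const: "has_grad (\<lambda>_. c) 0 x"
  by (simp add: has_grad_def)

lemma has_grad_nth: "has_grad (\<lambda>x. x $ i) (axis i 1) x"
proof -
  have "(\<lambda>v. \<Sum>l\<in>UNIV. axis i 1 $ l * v $ l) = (\<lambda>v :: complex ^ 'a. v $ i)"
    by (simp add: axis_def if_distrib [of "\<lambda>c. c * _"] cong: if_cong)
  then show ?thesis
    using bounded_linear_imp_has_derivative [OF bounded_linear_vec_nth, of i "at x"]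
    by (simp add: has_grad_def)
qed

lemma has_grad_add:
  assumes "has_grad f F x" "has_grad g G x"
  shows "has_grad (\<lambda>x. f x + g x) (F + G) x"
  using has_derivative_add [OF assms [unfolded has_grad_def]]
  by (simp add: has_grad_def distrib_right sum.distrib)

lemma has_grad_diff:
  assumes "has_grad f F x" "has_grad g G x"
  shows "has_grad (\<lambda>x. f x - g x) (F - G) x"
  using has_derivative_diff [OF assms [unfolded has_grad_def]]
  by (simp add: has_grad_def left_diff_distrib sum_subtractf)

lemma has_grad_mult:
  assumes "has_grad f F x" "has_grad g G x"
  shows "has_grad (\<lambda>x. f x * g x) (f x *s G + g x *s F) x"
  using has_derivative_mult [OF assms [unfolded has_grad_def]]
  by (simp add: has_grad_def distrib_right sum.distrib sum_distrib_left sum_distrib_right algebra_simps)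

lemma has_grad_compose:
  assumes "has_grad f F x" "(h has_field_derivative h') (at (f x))"
  shows "has_grad (\<lambda>x. h (f x)) (h' *s F) x"
  using has_derivative_compose [OF assms(1) [unfolded has_grad_def]
      assms(2) [unfolded has_field_derivative_def]]
  by (simp add: has_grad_def sum_distrib_left ac_simps)

lemma bounded_linear_vector_smult: "bounded_linear (\<lambda>t :: complex. t *s (v :: complex ^ 'n))"
proof (intro bounded_linear_intro [where K = "norm v"])
  show "norm (t *s v) \<le> norm t * norm v" for t
    by (simp add: norm_vec_def norm_mult L2_set_right_distrib)
qed (auto simp: vec_eq_iff algebra_simps)

lemma has_grad_line:
  assumes "has_grad f F (x + t *s v)"
  shows "((\<lambda>t. f (x + t *s v)) has_field_derivative (\<Sum>l\<in>UNIV. F $ l * v $ l)) (at t)"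
proof -
  have "((\<lambda>t. x + t *s v) has_derivative (\<lambda>t. t *s v)) (at t)"
    by (auto intro!: derivative_eq_intros bounded_linear_imp_has_derivative bounded_linear_vector_smult)
  from has_derivative_compose [OF this assms [unfolded has_grad_def]]
  show ?thesis
    by (auto elim!: has_derivative_eq_rhs simp: has_field_derivative_def sum_distrib_left fun_eq_iff ac_simps)
qed

lemma has_grad_partial:
  assumes "has_grad f F x"
  shows "partial f l x = F $ l"
proof -
  have "(\<Sum>k\<in>UNIV. F $ k * axis l 1 $ k) = F $ l"
    by (simp add: axis_def if_distrib [of "\<lambda>c. _ * c"] cong: if_cong)
  then show ?thesis
    using has_grad_line [of f F x 0 "axis l 1"] assms by (simp add: partial_def DERIV_imp_deriv)
qed

lemma has_grad_differential: "has_grad f F x \<Longrightarrow> differential f x = F"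
  by (simp add: differential_def has_grad_partial vec_eq_iff)

lemma holo_on_iff_has_grad: "holo_on f U \<longleftrightarrow> (\<forall>x\<in>U. \<exists>F. has_grad f F x)"
proof
  assume f: "holo_on f U"
  show "\<forall>x\<in>U. \<exists>F. has_grad f F x"
  proof
    fix x assume "x \<in> U"
    then obtain D where D: "(f has_derivative D) (at x)" "\<And>c v. D (c *s v) = c * D v"
      using f by (auto simp: holo_on_def)
    interpret D: bounded_linear D using D(1) by (rule has_derivative_bounded_linear)
    have "D v = (\<Sum>l\<in>UNIV. (\<chi> l. D (axis l 1)) $ l * v $ l)" for v
    proof -
      have "v = (\<Sum>l\<in>UNIV. v $ l *s axis l 1)"
        by (simp add: vec_eq_iff axis_def if_distrib [of "\<lambda>c. _ * c"] cong: if_cong)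
      then have "D v = D (\<Sum>l\<in>UNIV. v $ l *s axis l 1)" by simp
      also have "\<dots> = (\<Sum>l\<in>UNIV. v $ l * D (axis l 1))" by (simp add: D.sum D(2))
      finally show ?thesis by (simp add: mult.commute)
    qed
    then have "D = (\<lambda>v. \<Sum>l\<in>UNIV. (\<chi> l. D (axis l 1)) $ l * v $ l)" by blast
    then have "has_grad f (\<chi> l. D (axis l 1)) x"
      using D(1) unfolding has_grad_def by metis
    then show "\<exists>F. has_grad f F x" ..
  qed
next
  assume "\<forall>x\<in>U. \<exists>F. has_grad f F x"
  then show "holo_on f U"
    unfolding holo_on_def has_grad_def by (fastforce simp: sum_distrib_left ac_simps)
qed

lemma has_grad_imp_isCont: "has_grad f F x \<Longrightarrow> isCont f x"
  unfolding has_grad_def by (rule has_derivative_continuous)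

section \<open>Differentials and cardinalities of the web\<close>

fun WB_grad :: "'n::finite wb_index \<Rightarrow> complex ^ 'n \<Rightarrow> complex ^ 'n" where
  "WB_grad (Coord i) x = axis i 1"
| "WB_grad (Add2 i j) x = axis i 1 + axis j 1"
| "WB_grad (Diff2 i j) x = axis j 1 - axis i 1"
| "WB_grad (Mult2 i j) x = x $ i *s axis j 1 + x $ j *s axis i 1"
| "WB_grad (Add3 i j k) x = axis i 1 + axis j 1 + axis k 1"
| "WB_grad (Squares3 i j k) x = (2 * x $ i) *s axis i 1 + (2 * x $ j) *s axis j 1 + (2 * x $ k) *s axis k 1"
| "WB_grad (Mult3 i j k) x =
     (x $ i * x $ j) *s axis k 1 + (x $ i * x $ k) *s axis j 1 + (x $ j * x $ k) *s axis i 1"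
| "WB_grad (Mult4 i j k m) x =
     (x $ i * x $ j * x $ k) *s axis m 1 + (x $ i * x $ j * x $ m) *s axis k 1 +
     (x $ i * x $ k * x $ m) *s axis j 1 + (x $ j * x $ k * x $ m) *s axis i 1"

text \<open>Leaves the gradient schematic, so that the differentiation rules compute one that is
  compared with the stated form afterwards.\<close>

lemma has_grad_eq_rhs: "has_grad f F x \<Longrightarrow> F = G \<Longrightarrow> has_grad f G x"
  by simp

lemmas has_grad_intros = has_grad_const has_grad_nth has_grad_add has_grad_diff has_grad_mult

lemma has_grad_WB: "has_grad (WB a) (WB_grad a x) x"
proof (cases a)
  case (Coord i)
  show ?thesis unfolding Coord WB.simps power2_eq_square
    by (rule has_grad_eq_rhs, (rule has_grad_intros)+) (simp add: vec_eq_iff algebra_simps)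
next
  case (Add2 i j)
  show ?thesis unfolding Add2 WB.simps power2_eq_square
    by (rule has_grad_eq_rhs, (rule has_grad_intros)+) (simp add: vec_eq_iff algebra_simps)
next
  case (Diff2 i j)
  show ?thesis unfolding Diff2 WB.simps power2_eq_square
    by (rule has_grad_eq_rhs, (rule has_grad_intros)+) (simp add: vec_eq_iff algebra_simps)
next
  case (Mult2 i j)
  show ?thesis unfolding Mult2 WB.simps power2_eq_square
    by (rule has_grad_eq_rhs, (rule has_grad_intros)+) (simp add: vec_eq_iff algebra_simps)
next
  case (Add3 i j k)
  show ?thesis unfolding Add3 WB.simps power2_eq_square
    by (rule has_grad_eq_rhs, (rule has_grad_intros)+) (simp add: vec_eq_iff algebra_simps)
next
  case (Squares3 i j k)
  show ?thesis unfolding Squares3 WB.simps power2_eq_square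
    by (rule has_grad_eq_rhs, (rule has_grad_intros)+) (simp add: vec_eq_iff algebra_simps)
next
  case (Mult3 i j k)
  show ?thesis unfolding Mult3 WB.simps power2_eq_square
    by (rule has_grad_eq_rhs, (rule has_grad_intros)+) (simp add: vec_eq_iff algebra_simps)
next
  case (Mult4 i j k m)
  show ?thesis unfolding Mult4 WB.simps power2_eq_square
    by (rule has_grad_eq_rhs, (rule has_grad_intros)+) (simp add: vec_eq_iff algebra_simps)
qed

text \<open>Symmetry of the second derivatives. It serves both bounds: it makes f(u) du closed, and
  it makes the differential of lam proportional to du when lam du is closed.\<close>

lemma WB_grad_symmetric:
  "\<exists>H. (\<forall>k. has_grad (\<lambda>y. WB_grad a y $ k) (H k) x) \<and> (\<forall>k l. H k $ l = H l $ k)"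
proof (cases a)
  case (Coord i)
  show ?thesis unfolding Coord WB_grad.simps vector_add_component vector_minus_component vector_smult_component
    \<comment> \<open>The witness stays schematic until the differentiation rules fill it in; only
      its symmetry remains to be checked.\<close>
    by (rule exI, rule conjI, rule allI, (rule has_grad_intros)+) (simp add: algebra_simps)
next
  case (Add2 i j)
  show ?thesis unfolding Add2 WB_grad.simps vector_add_component vector_minus_component vector_smult_component
    by (rule exI, rule conjI, rule allI, (rule has_grad_intros)+) (simp add: algebra_simps)
next
  case (Diff2 i j)
  show ?thesis unfolding Diff2 WB_grad.simps vector_add_component vector_minus_component vector_smult_component
    by (rule exI, rule conjI, rule allI, (rule has_grad_intros)+) (simp add: algebra_simps)
next
  case (Mult2 i j)
  show ?thesis unfolding Mult2 WB_grad.simps vector_add_component vector_minus_component vector_smult_component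
    by (rule exI, rule conjI, rule allI, (rule has_grad_intros)+) (simp add: algebra_simps)
next
  case (Add3 i j k)
  show ?thesis unfolding Add3 WB_grad.simps vector_add_component vector_minus_component vector_smult_component
    by (rule exI, rule conjI, rule allI, (rule has_grad_intros)+) (simp add: algebra_simps)
next
  case (Squares3 i j k)
  show ?thesis unfolding Squares3 WB_grad.simps vector_add_component vector_minus_component vector_smult_component
    by (rule exI, rule conjI, rule allI, (rule has_grad_intros)+) (simp add: algebra_simps)
next
  case (Mult3 i j k)
  show ?thesis unfolding Mult3 WB_grad.simps vector_add_component vector_minus_component vector_smult_component
    by (rule exI, rule conjI, rule allI, (rule has_grad_intros)+) (simp add: algebra_simps)
next
  case (Mult4 i j k m)
  show ?thesis unfolding Mult4 WB_grad.simps vector_add_component vector_minus_component vector_smult_component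
    by (rule exI, rule conjI, rule allI, (rule has_grad_intros)+) (simp add: algebra_simps)
qed

section \<open>Counting increasing tuples and the families of the web\<close>

lemma card_strict_sorted_lists:
  "card {xs :: 'a::{finite,linorder} list. sorted_wrt (<) xs \<and> length xs = k} = CARD('a) choose k"
proof -
  have "bij_betw set {xs :: 'a list. sorted_wrt (<) xs \<and> length xs = k} {S. S \<subseteq> UNIV \<and> card S = k}"
    unfolding bij_betw_def
  proof (intro conjI equalityI subsetI)
    show "inj_on set {xs :: 'a list. sorted_wrt (<) xs \<and> length xs = k}"
      by (auto intro!: inj_onI strict_sorted_equal)
    show "S \<in> set ` {xs. sorted_wrt (<) xs \<and> length xs = k}" if "S \<in> {S. S \<subseteq> UNIV \<and> card S = k}"
      for S :: "'a set"
      using that by (intro image_eqI [of _ _ "sorted_list_of_set S"]) auto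
  qed (auto dest: strict_sorted_imp_sorted simp: distinct_card strict_sorted_iff)
  then show ?thesis
    using bij_betw_same_card n_subsets [of "UNIV :: 'a set" k] by fastforce
qed

lemma strict_sorted_lists_2:
  "{xs :: 'a::linorder list. sorted_wrt (<) xs \<and> length xs = 2} = {[i, j] | i j. i < j}"
  by (auto simp: numeral_2_eq_2 length_Suc_conv)

lemma strict_sorted_lists_3:
  "{xs :: 'a::linorder list. sorted_wrt (<) xs \<and> length xs = 3} = {[i, j, k] | i j k. i < j \<and> j < k}"
  by (auto simp: numeral_3_eq_3 length_Suc_conv)

lemma strict_sorted_lists_4:
  "{xs :: 'a::linorder list. sorted_wrt (<) xs \<and> length xs = 4} =
   {[i, j, k, m] | i j k m. i < j \<and> j < k \<and> k < m}"
  by (auto simp: eval_nat_numeral length_Suc_conv)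

lemma card_pairs:
  assumes "\<And>i j i' j'. f i j = f i' j' \<Longrightarrow> i = i' \<and> j = j'"
  shows "card {f i j | i j :: 'a::{finite,linorder}. i < j} = CARD('a) choose 2"
proof -
  have "{f i j | i j. i < j} = (\<lambda>xs. f (xs ! 0) (xs ! 1)) ` {[i, j] | i j. i < j}"
    by (force simp: image_iff)
  moreover have "inj_on (\<lambda>xs. f (xs ! 0) (xs ! 1)) {[i, j] | i j. i < j}"
    by (auto intro!: inj_onI dest: assms)
  ultimately show ?thesis
    using card_strict_sorted_lists [where 'a='a and k=2] by (simp add: card_image strict_sorted_lists_2)
qed

lemma card_triples:
  assumes "\<And>i j k i' j' k'. f i j k = f i' j' k' \<Longrightarrow> i = i' \<and> j = j' \<and> k = k'"
  shows "card {f i j k | i j k :: 'a::{finite,linorder}. i < j \<and> j < k} = CARD('a) choose 3"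
proof -
  have "{f i j k | i j k. i < j \<and> j < k} =
      (\<lambda>xs. f (xs ! 0) (xs ! 1) (xs ! 2)) ` {[i, j, k] | i j k. i < j \<and> j < k}"
    by (force simp: image_iff)
  moreover have "inj_on (\<lambda>xs. f (xs ! 0) (xs ! 1) (xs ! 2)) {[i, j, k] | i j k. i < j \<and> j < k}"
    by (auto intro!: inj_onI dest: assms)
  ultimately show ?thesis
    using card_strict_sorted_lists [where 'a='a and k=3] by (simp add: card_image strict_sorted_lists_3)
qed

lemma card_quadruples:
  assumes "\<And>i j k m i' j' k' m'. f i j k m = f i' j' k' m' \<Longrightarrow> i = i' \<and> j = j' \<and> k = k' \<and> m = m'"
  shows "card {f i j k m | i j k m :: 'a::{finite,linorder}. i < j \<and> j < k \<and> k < m} = CARD('a) choose 4"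
proof -
  have "{f i j k m | i j k m. i < j \<and> j < k \<and> k < m} =
      (\<lambda>xs. f (xs ! 0) (xs ! 1) (xs ! 2) (xs ! 3)) ` {[i, j, k, m] | i j k m. i < j \<and> j < k \<and> k < m}"
    by (force simp: image_iff)
  moreover have "inj_on (\<lambda>xs. f (xs ! 0) (xs ! 1) (xs ! 2) (xs ! 3))
      {[i, j, k, m] | i j k m. i < j \<and> j < k \<and> k < m}"
    by (auto intro!: inj_onI dest: assms)
  ultimately show ?thesis
    using card_strict_sorted_lists [where 'a='a and k=4] by (simp add: card_image strict_sorted_lists_4)
qed

lemma finite_wb_sets:
  "finite {f i j | i j :: 'a::{finite,linorder}. i < j}"
  "finite {g i j k | i j k :: 'a::{finite,linorder}. i < j \<and> j < k}"
  "finite {h i j k m | i j k m :: 'a::{finite,linorder}. i < j \<and> j < k \<and> k < m}"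
proof -
  have "{f i j | i j :: 'a. i < j} \<subseteq> (\<lambda>(i, j). f i j) ` UNIV" by auto
  then show "finite {f i j | i j :: 'a. i < j}" by (rule finite_subset) simp
  have "{g i j k | i j k :: 'a. i < j \<and> j < k} \<subseteq> (\<lambda>(i, j, k). g i j k) ` UNIV" by (auto simp: image_iff) blast
  then show "finite {g i j k | i j k :: 'a. i < j \<and> j < k}" by (rule finite_subset) simp
  have "{h i j k m | i j k m :: 'a. i < j \<and> j < k \<and> k < m} \<subseteq> (\<lambda>(i, j, k, m). h i j k m) ` UNIV" by (auto simp: image_iff) blast
  then show "finite {h i j k m | i j k m :: 'a. i < j \<and> j < k \<and> k < m}" by (rule finite_subset) simp
qed

text \<open>A sum instead of a cardinality, because it is used twice: with weight 1 to count
  functions, and with weight \<open>card (wb_leads a)\<close> to count relations.\<close>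

lemma sum_WB_index:
  fixes f :: "'n::{finite,linorder} wb_index \<Rightarrow> nat"
  shows "sum f WB_index = sum f (range Coord) +
     sum f {Add2 i j | i j. i < j} + sum f {Diff2 i j | i j. i < j} + sum f {Mult2 i j | i j. i < j} +
     sum f {Add3 i j k | i j k. i < j \<and> j < k} + sum f {Squares3 i j k | i j k. i < j \<and> j < k} +
     sum f {Mult3 i j k | i j k. i < j \<and> j < k} +
     sum f {Mult4 i j k m | i j k m. i < j \<and> j < k \<and> k < m}"
  unfolding WB_index_def simp_thms full_SetCompr_eq
  by (subst sum.union_disjoint; auto simp: finite_wb_sets)+

lemma card_Coord: "card (range (Coord :: 'n::{finite,linorder} \<Rightarrow> _)) = CARD('n)"
  by (simp add: card_image inj_on_def)

lemma card_wb_families: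
  "card {Add2 i j | i j :: 'n::{finite,linorder}. i < j} = CARD('n) choose 2"
  "card {Diff2 i j | i j :: 'n::{finite,linorder}. i < j} = CARD('n) choose 2"
  "card {Mult2 i j | i j :: 'n::{finite,linorder}. i < j} = CARD('n) choose 2"
  "card {Add3 i j k | i j k :: 'n::{finite,linorder}. i < j \<and> j < k} = CARD('n) choose 3"
  "card {Squares3 i j k | i j k :: 'n::{finite,linorder}. i < j \<and> j < k} = CARD('n) choose 3"
  "card {Mult3 i j k | i j k :: 'n::{finite,linorder}. i < j \<and> j < k} = CARD('n) choose 3"
  "card {Mult4 i j k m | i j k m :: 'n::{finite,linorder}. i < j \<and> j < k \<and> k < m} = CARD('n) choose 4"
  by (rule card_pairs card_triples card_quadruples; simp)+

lemma finite_WB_index: "finite (WB_index :: 'n::{finite,linorder} wb_index set)"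
  unfolding WB_index_def by (simp add: finite_wb_sets full_SetCompr_eq)

lemma card_WB_index:
  "card (WB_index :: 'n::{finite,linorder} wb_index set) =
   CARD('n) + 3 * (CARD('n) choose 2) + 3 * (CARD('n) choose 3) + (CARD('n) choose 4)"
  using sum_WB_index [where 'n='n and f="\<lambda>_. 1"] by (simp add: card_wb_families card_Coord)

section \<open>The numbers c(n,h) and the value of \<open>pi'\<close>\<close>

lemma cdim_binomial: "cdim n h = (n - 1 + h) choose h"
  by (simp add: cdim_def binomial_fact' mult.commute)

text \<open>The coefficients come from sorting the monomials of degree h by support: binom(h-1,s-1)
  of them have a given support of size s. The verification uses Pascal's rule instead.\<close>

lemma cdim_low:
  assumes "n \<ge> 1"
  shows "cdim n 1 = n" "cdim n 2 = n + (n choose 2)" "cdim n 3 = n + 2 * (n choose 2) + (n choose 3)"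
    "cdim n 4 = n + 3 * (n choose 2) + 3 * (n choose 3) + (n choose 4)"
proof -
  obtain m where n: "n = m + 1" using assms by (metis le_add_diff_inverse2)
  have m: "m + 1 - 1 + h = m + h" for h by simp
  have "m + 2 = Suc (m + 1)" "m + 3 = Suc (m + 2)" "m + 4 = Suc (m + 3)" "2 = Suc 1" "3 = Suc 2" "4 = Suc 3"
    by simp_all
  then have pascal:
    "(m + 2 choose 2) = (m + 1 choose 1) + (m + 1 choose 2)"
    "(m + 2 choose 3) = (m + 1 choose 2) + (m + 1 choose 3)"
    "(m + 2 choose 4) = (m + 1 choose 3) + (m + 1 choose 4)"
    "(m + 3 choose 3) = (m + 2 choose 2) + (m + 2 choose 3)"
    "(m + 3 choose 4) = (m + 2 choose 3) + (m + 2 choose 4)"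
    "(m + 4 choose 4) = (m + 3 choose 3) + (m + 3 choose 4)"
    by (metis binomial_Suc_Suc)+
  have one: "(m + 1 choose 1) = m + 1" by simp
  show "cdim n 1 = n" "cdim n 2 = n + (n choose 2)" "cdim n 3 = n + 2 * (n choose 2) + (n choose 3)"
    "cdim n 4 = n + 3 * (n choose 2) + 3 * (n choose 3) + (n choose 4)"
    unfolding cdim_binomial n m pascal one by linarith+
qed

text \<open>By Pascal's rule the increment is a binomial coefficient, positive once n is at least 2.
  For n = 1 the sequence is constant and \<open>k0\<close> would have no meaning.\<close>

lemma cdim_strict_mono:
  assumes "n \<ge> 2" "h < k"
  shows "cdim n h < cdim n k"
proof -
  have "cdim n i < cdim n (Suc i)" for i
  proof -
    obtain m where "n = 2 + m" using assms(1) le_Suc_ex by blast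
    then have m: "n = Suc (Suc m)" by simp
    have "(Suc (m + i) choose Suc i) > 0" by simp
    then show ?thesis unfolding cdim_binomial m
      by (simp add: add.commute)
  qed
  then show ?thesis using assms(2) by (rule lift_Suc_mono_less)
qed

lemma cdim_mono: "n \<ge> 2 \<Longrightarrow> h \<le> k \<Longrightarrow> cdim n h \<le> cdim n k"
  using cdim_strict_mono [of n h k] by (cases "h = k") auto

lemma k0_cdim:
  assumes "n \<ge> 2"
  shows "k0 n (cdim n k) = k"
  unfolding k0_def
proof (rule the_equality)
  show "cdim n k \<le> cdim n k \<and> cdim n k < cdim n (k + 1)"
    using cdim_strict_mono [OF assms] by simp
  fix j assume "cdim n j \<le> cdim n k \<and> cdim n k < cdim n (j + 1)"
  then show "j = k"
    using cdim_strict_mono [OF assms, of k j] cdim_mono [OF assms, of "j + 1" k] by (cases k j rule: linorder_cases) auto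
qed

text \<open>The levels h = 1, 2, 3 contribute 3 + 2 + 1 for each pair, 3 + 3 + 2 for each triple and
  1 + 1 + 1 for each quadruple; the level h = 4 contributes 0.\<close>

lemma pi'_cdim4:
  assumes "n \<ge> 2"
  shows "pi' n (cdim n 4) = 6 * (n choose 2) + 8 * (n choose 3) + 3 * (n choose 4)"
proof -
  have "{1..4} = {1, 2, 3, 4 :: nat}" by auto
  then show ?thesis
    using assms unfolding pi'_def k0_cdim [OF assms] by (simp add: cdim_low cdim_low(1) [unfolded One_nat_def])
qed

text \<open>An enumeration of the index type turns multi-indices into lists of fixed length and sum,
  which are counted by stars and bars.\<close>

lemma card_multi_indices: "card {L :: 'n::finite \<Rightarrow> nat. (\<Sum>l\<in>UNIV. L l) = h} = cdim CARD('n) h"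
proof -
  obtain xs :: "'n list" where xs: "set xs = UNIV" "distinct xs"
    using finite_distinct_list [OF finite [of "UNIV :: 'n set"]] by blast
  have len: "length xs = CARD('n)" using distinct_card [OF xs(2)] unfolding xs(1) by (rule sym)
  have "bij_betw (\<lambda>L. map L xs) {L. (\<Sum>l\<in>UNIV. L l) = h} {l. size l = CARD('n) \<and> sum_list l = h}"
    unfolding bij_betw_def
  proof (intro conjI equalityI subsetI)
    show "inj_on (\<lambda>L. map L xs) {L. (\<Sum>l\<in>UNIV. L l) = h}"
    proof (intro inj_onI ext)
      fix L L' :: "'n \<Rightarrow> nat" and p assume "map L xs = map L' xs"
      then have "\<forall>p\<in>set xs. L p = L' p" by (simp only: map_eq_conv)
      then show "L p = L' p" unfolding xs(1) by blast
    qed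
    have sum: "sum_list (map L xs) = (\<Sum>l\<in>UNIV. L l)" for L :: "'n \<Rightarrow> nat"
      using xs by (simp add: sum_list_distinct_conv_sum_set)
    then show "l \<in> {l. size l = CARD('n) \<and> sum_list l = h}"
      if "l \<in> (\<lambda>L. map L xs) ` {L. (\<Sum>l\<in>UNIV. L l) = h}" for l
      using that len by auto
    fix l assume l: "l \<in> {l. size l = CARD('n) \<and> sum_list l = h}"
    define L where "L p = the (map_of (zip xs l) p)" for p
    have "map L xs = l"
      using l len xs unfolding L_def by (intro nth_equalityI) (auto simp: map_of_zip_nth)
    then show "l \<in> (\<lambda>L. map L xs) ` {L. (\<Sum>l\<in>UNIV. L l) = h}"
      using l sum [of L] by auto
  qed
  from bij_betw_same_card [OF this] show ?thesis
    by (simp add: card_length_sum_list cdim_binomial add.commute Suc_le_eq)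
qed

text \<open>For each support there are as many functions as monomials of degree \<open>h\<close>
  with that support: 1 for a single variable, \<open>h - 1\<close> for a pair, and one for a triple
  when \<open>h = 3\<close>. All of them have constant differentials.\<close>

definition WB_low :: "nat \<Rightarrow> 'n::{finite,linorder} wb_index set" where
  "WB_low h = range Coord \<union> (if 2 \<le> h then {Add2 i j | i j. i < j} else {}) \<union>
     (if 3 \<le> h then {Diff2 i j | i j. i < j} \<union> {Add3 i j k | i j k. i < j \<and> j < k} else {})"

lemma WB_low_subset: "WB_low h \<subseteq> WB_index"
  by (auto simp: WB_low_def WB_index_def)

lemma card_WB_low:
  assumes "h \<in> {1, 2, 3}"
  shows "card (WB_low h :: 'n::{finite,linorder} wb_index set) = cdim CARD('n) h"
proof -
  have n: "CARD('n) \<ge> 1" by (simp add: Suc_le_eq)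
  consider "h = 1" | "h = 2" | "h = 3" using assms by blast
  then show ?thesis
  proof cases
    case 1
    then show ?thesis using cdim_low(1) [OF n] by (simp add: WB_low_def card_Coord)
  next
    case 2
    have "card (range Coord \<union> {Add2 i j | i j :: 'n. i < j}) = CARD('n) + (CARD('n) choose 2)"
      by (subst card_Un_disjoint) (auto simp: finite_wb_sets card_wb_families card_Coord)
    with 2 show ?thesis using cdim_low(2) [OF n] by (simp add: WB_low_def)
  next
    case 3
    have 1: "card (range Coord \<union> {Add2 i j | i j :: 'n. i < j}) = CARD('n) + (CARD('n) choose 2)"
      by (subst card_Un_disjoint) (auto simp: finite_wb_sets card_wb_families card_Coord)
    have 2: "card ({Diff2 i j | i j :: 'n. i < j} \<union> {Add3 i j k | i j k. i < j \<and> j < k}) =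
        (CARD('n) choose 2) + (CARD('n) choose 3)"
      by (subst card_Un_disjoint) (auto simp: finite_wb_sets card_wb_families card_Coord)
    have "card ((range Coord \<union> {Add2 i j | i j :: 'n. i < j}) \<union>
        ({Diff2 i j | i j. i < j} \<union> {Add3 i j k | i j k. i < j \<and> j < k})) =
        CARD('n) + (CARD('n) choose 2) + ((CARD('n) choose 2) + (CARD('n) choose 3))"
      unfolding 1 [symmetric] 2 [symmetric]
      by (rule card_Un_disjoint) (auto simp: finite_wb_sets)
    with 3 show ?thesis using cdim_low(3) [OF n] by (simp add: WB_low_def)
  qed
qed

section \<open>Relations among powers of the differentials\<close>

text \<open>The relation between the h-th powers of the forms \<open>L a\<close>, coefficient by
  coefficient. A monomial is the list of its variables with repetition: multiplying by a test
  monomial is then appending lists, and polarization is induction on the list.\<close>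

definition power_relation :: "'i set \<Rightarrow> ('i \<Rightarrow> complex ^ 'n) \<Rightarrow> nat \<Rightarrow> ('i \<Rightarrow> complex) \<Rightarrow> bool" where
  "power_relation I L h c \<longleftrightarrow> (\<forall>ps. length ps = h \<longrightarrow> (\<Sum>a\<in>I. c a * (\<Prod>p\<leftarrow>ps. L a $ p)) = 0)"

lemma power_relationD:
  "power_relation I L h c \<Longrightarrow> length ps = h \<Longrightarrow> (\<Sum>a\<in>I. c a * (\<Prod>p\<leftarrow>ps. L a $ p)) = 0"
  by (simp add: power_relation_def)

lemma power_relation_restrict:
  assumes "finite I" "J \<subseteq> I" "\<And>a. a \<in> I - J \<Longrightarrow> c a = 0"
  shows "power_relation J L h c \<longleftrightarrow> power_relation I L h c"
proof -
  have "(\<Sum>a\<in>I. c a * f a) = (\<Sum>a\<in>J. c a * f a)" for f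
    using assms by (intro sum.mono_neutral_right) auto
  then show ?thesis by (simp add: power_relation_def)
qed

text \<open>Polarization: the coefficient of \<open>t\<close> in the relation at \<open>v + t e\<^sub>p\<close> splits off a factor \<open>L a $ p\<close>.\<close>

lemma power_relation_polarize:
  fixes L :: "'i \<Rightarrow> complex ^ 'n::finite"
  assumes "\<And>v. (\<Sum>a\<in>I. c a * (\<Sum>l\<in>UNIV. L a $ l * v $ l) ^ h) = 0"
  shows "power_relation I L h c"
  using assms
proof (induction h arbitrary: c)
  case 0
  then show ?case by (simp add: power_relation_def)
next
  case (Suc h)
  let ?d = "\<lambda>a v. \<Sum>l\<in>UNIV. L a $ l * v $ l"
  have "power_relation I L h (\<lambda>a. c a * L a $ p)" for p
  proof (rule Suc.IH)
    fix v
    have d: "?d a (v + t *s axis p 1) = ?d a v + t * L a $ p" for a t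
      by (simp add: distrib_left sum.distrib axis_def if_distrib [of "\<lambda>c. _ * c"] mult.commute cong: if_cong)
    have "((\<lambda>t. \<Sum>a\<in>I. c a * (?d a v + t * L a $ p) ^ Suc h) has_field_derivative
        (\<Sum>a\<in>I. c a * ((1 + of_nat h) * (L a $ p * ?d a v ^ h)))) (at 0)"
    proof (intro DERIV_sum DERIV_cmult)
      fix a
      have "((\<lambda>t. ?d a v + t * L a $ p) has_field_derivative L a $ p) (at 0)"
        by (auto intro!: derivative_eq_intros)
      from DERIV_power_Suc [OF this, of h]
      show "((\<lambda>t. (?d a v + t * L a $ p) ^ Suc h) has_field_derivative
          (1 + of_nat h) * (L a $ p * ?d a v ^ h)) (at 0)" by simp
    qed
    moreover have "(\<lambda>t. \<Sum>a\<in>I. c a * (?d a v + t * L a $ p) ^ Suc h) = (\<lambda>_. 0)"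
      using Suc.prems by (simp only: d [symmetric])
    ultimately have "((\<lambda>_. 0) has_field_derivative
        (\<Sum>a\<in>I. c a * ((1 + of_nat h) * (L a $ p * ?d a v ^ h)))) (at (0 :: complex))"
      by simp
    then have "(\<Sum>a\<in>I. c a * ((1 + of_nat h) * (L a $ p * ?d a v ^ h))) = 0"
      by (rule DERIV_unique) (rule DERIV_const)
    then have "(1 + of_nat h) * (\<Sum>a\<in>I. c a * L a $ p * ?d a v ^ h) = (0 :: complex)"
      by (simp only: sum_distrib_left ac_simps)
    then show "(\<Sum>a\<in>I. c a * L a $ p * ?d a v ^ h) = 0"
      using of_nat_neq_0 [of h, where 'a=complex] unfolding of_nat_Suc mult_eq_0_iff by blast
  qed
  then show ?case
    unfolding power_relation_def by (auto simp: length_Suc_conv mult.assoc)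
qed

text \<open>Translation between lists and multi-indices: the list \<open>ps\<close> gives the same
  monomial as its multiplicities \<open>count_list ps\<close>, a multi-index of weight
  \<open>h\<close>.\<close>

lemma power_relation_P_column:
  fixes u :: "'i \<Rightarrow> complex ^ 'n \<Rightarrow> complex"
  assumes "\<And>a. a \<in> I \<Longrightarrow> differential (u a) x = L a"
    and "\<And>K. (\<Sum>a\<in>I. c a * P_column u h x a K) = 0"
  shows "power_relation I L h c"
  unfolding power_relation_def
proof (intro allI impI)
  fix ps :: "'n list" assume ps: "length ps = h"
  have "(\<Prod>p\<leftarrow>ps. f p) = (\<Prod>p\<in>UNIV. f p ^ count_list ps p)" for f :: "'n \<Rightarrow> complex"
  proof (induction ps)
    case (Cons a ps)
    have "f p ^ count_list (a # ps) p = (if a = p then f p else 1) * f p ^ count_list ps p" for p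
      by simp
    then show ?case using Cons by (simp add: prod.distrib)
  qed simp
  moreover have "(\<Sum>p\<in>UNIV. count_list ps p) = h"
    using ps by (simp add: sum_count_set)
  moreover have "partial (u a) l x = L a $ l" if "a \<in> I" for a l
    using assms(1) [OF that] by (auto simp: differential_def vec_eq_iff)
  ultimately show "(\<Sum>a\<in>I. c a * (\<Prod>p\<leftarrow>ps. L a $ p)) = 0"
    using assms(2) [of "count_list ps"] by (simp add: P_column_def)
qed

section \<open>Elimination of relations support by support\<close>

definition WB_locus :: "(complex ^ 'n) set" where
  "WB_locus = {x. (\<forall>i. x $ i \<noteq> 0) \<and> (\<forall>i j. i \<noteq> j \<longrightarrow> x $ i \<noteq> x $ j \<and> x $ i \<noteq> - x $ j)}"

fun WB_support :: "'n wb_index \<Rightarrow> 'n set" where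
  "WB_support (Coord i) = {i}"
| "WB_support (Add2 i j) = {i, j}"
| "WB_support (Diff2 i j) = {i, j}"
| "WB_support (Mult2 i j) = {i, j}"
| "WB_support (Add3 i j k) = {i, j, k}"
| "WB_support (Squares3 i j k) = {i, j, k}"
| "WB_support (Mult3 i j k) = {i, j, k}"
| "WB_support (Mult4 i j k m) = {i, j, k, m}"

lemma WB_grad_eq_0: "p \<notin> WB_support a \<Longrightarrow> WB_grad a x $ p = 0"
  by (cases a) (auto simp: axis_def)

text \<open>This and the next three lemmas identify the block that survives at each stage: with
  larger supports already eliminated, a function whose support contains the given set has that set
  as support, and the order of the indices fixes its arguments.\<close>

lemma WB_support_4:
  assumes "i < j" "j < k" "k < m" "{i, j, k, m} \<subseteq> WB_support a" "a \<in> WB_index"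
  shows "a = Mult4 i j k (m :: 'n::{finite,linorder})"
  using assms by (cases a) (auto simp: WB_index_def)

lemma WB_support_3:
  assumes "i < j" "j < k" "{i, j, k} \<subseteq> WB_support a" "a \<in> WB_index" "\<And>i j k m. a \<noteq> Mult4 i j k m"
  shows "a \<in> {Add3 i j k, Squares3 i j k, Mult3 i j (k :: 'n::{finite,linorder})}"
  using assms by (cases a) (auto simp: WB_index_def)

lemma WB_support_2:
  assumes "i < j" "{i, j} \<subseteq> WB_support a" "a \<in> WB_index" "\<And>i j k m. a \<noteq> Mult4 i j k m"
    "\<And>i j k. a \<notin> {Add3 i j k, Squares3 i j k, Mult3 i j k}"
  shows "a \<in> {Add2 i j, Diff2 i j, Mult2 i (j :: 'n::{finite,linorder})}"
  using assms by (cases a) (auto simp: WB_index_def)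

lemma WB_support_1:
  assumes "i \<in> WB_support a" "\<And>i j k m. a \<noteq> Mult4 i j k m"
    "\<And>i j k. a \<notin> {Add3 i j k, Squares3 i j k, Mult3 i j k}"
    "\<And>i j. a \<notin> {Add2 i j, Diff2 i j, Mult2 i j}"
  shows "a = Coord i"
  using assms by (cases a) auto

text \<open>A differential has no component outside the support of its function, so testing on the
  monomial \<open>ps\<close> sees only functions whose support contains all variables of
  \<open>ps\<close>.\<close>

lemma power_relation_support:
  fixes c :: "'n::{finite,linorder} wb_index \<Rightarrow> complex"
  assumes "power_relation WB_index (\<lambda>a. WB_grad a x) h c" "length ps = h" "T \<subseteq> WB_index"
    "\<And>a. a \<in> WB_index \<Longrightarrow> c a \<noteq> 0 \<Longrightarrow> set ps \<subseteq> WB_support a \<Longrightarrow> a \<in> T"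
  shows "(\<Sum>a\<in>T. c a * (\<Prod>p\<leftarrow>ps. WB_grad a x $ p)) = 0"
proof -
  have "(\<Sum>a\<in>WB_index. c a * (\<Prod>p\<leftarrow>ps. WB_grad a x $ p)) = (\<Sum>a\<in>T. c a * (\<Prod>p\<leftarrow>ps. WB_grad a x $ p))"
  proof (rule sum.mono_neutral_right [OF finite_WB_index assms(3)], safe)
    fix a assume "a \<in> WB_index" "a \<notin> T"
    then show "c a * (\<Prod>p\<leftarrow>ps. WB_grad a x $ p) = 0"
      using assms(4) [of a] WB_grad_eq_0 [of _ a x] by (force simp: prod_list_zero_iff)
  qed
  then show ?thesis using power_relationD [OF assms(1,2)] by simp
qed

text \<open>A polynomial of degree at most 2 with three distinct roots; two divided differences
  suffice.\<close>

lemma vandermonde_3: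
  fixes \<alpha> \<beta> \<gamma> a b c :: complex
  assumes "\<alpha> + \<beta> * a ^ 2 + \<gamma> * a = 0" "\<alpha> + \<beta> * b ^ 2 + \<gamma> * b = 0" "\<alpha> + \<beta> * c ^ 2 + \<gamma> * c = 0"
    "a \<noteq> b" "a \<noteq> c" "b \<noteq> c"
  shows "\<alpha> = 0 \<and> \<beta> = 0 \<and> \<gamma> = 0"
proof -
  have "(a - b) * (\<beta> * (a + b) + \<gamma>) = 0" "(a - c) * (\<beta> * (a + c) + \<gamma>) = 0"
    using assms(1-3) by algebra+
  then have 1: "\<beta> * (a + b) + \<gamma> = 0" "\<beta> * (a + c) + \<gamma> = 0" using assms(4,5) by auto
  then have "\<beta> * (b - c) = 0" by algebra
  then show ?thesis using 1 assms by auto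
qed

text \<open>For each support the unknown coefficients are as many as the quartic monomials with
  exactly this support. These square systems are solved from large supports to small ones, and their
  determinants do not vanish on \<open>WB_locus\<close>.\<close>

lemma power_relation_4_imp_0:
  fixes c :: "'n::{finite,linorder} wb_index \<Rightarrow> complex"
  assumes x: "x \<in> WB_locus" and R: "power_relation WB_index (\<lambda>a. WB_grad a x) 4 c"
    and a: "a \<in> WB_index"
  shows "c a = 0"
proof -
  have nz: "x $ i \<noteq> 0" and ne: "i \<noteq> j \<Longrightarrow> x $ i \<noteq> x $ j" "i \<noteq> j \<Longrightarrow> x $ i \<noteq> - x $ j" for i j
    using x by (auto simp: WB_locus_def)
  have Mult4: "c (Mult4 i j k m) = 0" if "i < j" "j < k" "k < m" for i j k m
  proof -
    have "(\<Sum>a\<in>{Mult4 i j k m}. c a * (\<Prod>p\<leftarrow>[i, j, k, m]. WB_grad a x $ p)) = 0"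
      by (rule power_relation_support [OF R]; use that in \<open>auto simp: WB_index_def dest!: WB_support_4 [OF that]\<close>)
    moreover have "i \<noteq> j" "i \<noteq> k" "i \<noteq> m" "j \<noteq> k" "j \<noteq> m" "k \<noteq> m" using that by auto
    ultimately show ?thesis by (simp add: axis_def nz)
  qed
  then have Mult4': "a \<noteq> Mult4 i j k m" if "a \<in> WB_index" "c a \<noteq> 0" for a i j k m
    using that by (auto simp: WB_index_def)
  have triple: "c (Add3 i j k) = 0 \<and> c (Squares3 i j k) = 0 \<and> c (Mult3 i j k) = 0"
    if "i < j" "j < k" for i j k
  proof -
    \<comment> \<open>The test monomials are the three quartic ones with support exactly {i, j,
      k}.\<close>
    have S: "(\<Sum>a\<in>{Add3 i j k, Squares3 i j k, Mult3 i j k}. c a * (\<Prod>p\<leftarrow>ps. WB_grad a x $ p)) = 0"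
      if "ps \<in> {[i, j, k, i], [i, j, k, j], [i, j, k, k]}" for ps
    proof (rule power_relation_support [OF R])
      fix a assume "a \<in> WB_index" "c a \<noteq> 0" "set ps \<subseteq> WB_support a"
      then show "a \<in> {Add3 i j k, Squares3 i j k, Mult3 i j k}"
        using that by (intro WB_support_3 [OF \<open>i < j\<close> \<open>j < k\<close>] Mult4') auto
    qed (use that \<open>i < j\<close> \<open>j < k\<close> in \<open>auto simp: WB_index_def\<close>)
    have d: "i \<noteq> j" "i \<noteq> k" "j \<noteq> k" using that by auto
    \<comment> \<open>On the monomial ijk*l with l in {i, j, k}, the form of \<open>Squares3\<close>
      has the product 2^4 * x_i * x_j * x_k * x_l, and that of \<open>Mult3\<close> has p^3 / x_l
      with p = x_i * x_j * x_k.\<close>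
    let ?\<alpha> = "c (Add3 i j k)" and ?\<beta> = "16 * x $ i * x $ j * x $ k * c (Squares3 i j k)"
      and ?\<gamma> = "c (Mult3 i j k)" and ?p = "x $ i * x $ j * x $ k"
    have "?\<alpha> + ?\<beta> * x $ i + ?\<gamma> * ?p ^ 2 * (x $ j * x $ k) = 0"
      "?\<alpha> + ?\<beta> * x $ j + ?\<gamma> * ?p ^ 2 * (x $ i * x $ k) = 0"
      "?\<alpha> + ?\<beta> * x $ k + ?\<gamma> * ?p ^ 2 * (x $ i * x $ j) = 0"
      using S [of "[i, j, k, i]"] S [of "[i, j, k, j]"] S [of "[i, j, k, k]"] d
      by (simp_all add: axis_def power2_eq_square algebra_simps)
    \<comment> \<open>These factors make the \<open>Mult3\<close> term equal to
      \<open>?\<gamma> * ?p ^ 3\<close> in all three equations: one quadratic polynomial then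
      vanishes at three distinct points.\<close>
    then have "x $ i * (?\<alpha> + ?\<beta> * x $ i + ?\<gamma> * ?p ^ 2 * (x $ j * x $ k)) = 0"
      "x $ j * (?\<alpha> + ?\<beta> * x $ j + ?\<gamma> * ?p ^ 2 * (x $ i * x $ k)) = 0"
      "x $ k * (?\<alpha> + ?\<beta> * x $ k + ?\<gamma> * ?p ^ 2 * (x $ i * x $ j)) = 0"
      by simp_all
    then have "?\<gamma> * ?p ^ 3 + ?\<beta> * x $ i ^ 2 + ?\<alpha> * x $ i = 0"
      "?\<gamma> * ?p ^ 3 + ?\<beta> * x $ j ^ 2 + ?\<alpha> * x $ j = 0" "?\<gamma> * ?p ^ 3 + ?\<beta> * x $ k ^ 2 + ?\<alpha> * x $ k = 0"
      by algebra+
    from vandermonde_3 [OF this] show ?thesis using d nz ne by simp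
  qed
  then have triple': "a \<notin> {Add3 i j k, Squares3 i j k, Mult3 i j k}" if "a \<in> WB_index" "c a \<noteq> 0" for a i j k
    using that by (auto simp: WB_index_def)
  have pair: "c (Add2 i j) = 0 \<and> c (Diff2 i j) = 0 \<and> c (Mult2 i j) = 0" if "i < j" for i j
  proof -
    have S: "(\<Sum>a\<in>{Add2 i j, Diff2 i j, Mult2 i j}. c a * (\<Prod>p\<leftarrow>ps. WB_grad a x $ p)) = 0"
      if "ps \<in> {[i, i, i, j], [i, i, j, j], [i, j, j, j]}" for ps
    proof (rule power_relation_support [OF R])
      fix a assume "a \<in> WB_index" "c a \<noteq> 0" "set ps \<subseteq> WB_support a"
      then show "a \<in> {Add2 i j, Diff2 i j, Mult2 i j}"
        using that by (intro WB_support_2 [OF \<open>i < j\<close>] Mult4' triple') auto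
    qed (use that \<open>i < j\<close> in \<open>auto simp: WB_index_def\<close>)
    have d: "i \<noteq> j" using that by auto
    let ?\<alpha> = "c (Add2 i j)" and ?\<beta> = "c (Diff2 i j)" and ?\<gamma> = "c (Mult2 i j)"
    have e: "?\<alpha> - ?\<beta> + ?\<gamma> * (x $ i * x $ j ^ 3) = 0" "?\<alpha> + ?\<beta> + ?\<gamma> * (x $ i ^ 2 * x $ j ^ 2) = 0"
      "?\<alpha> - ?\<beta> + ?\<gamma> * (x $ i ^ 3 * x $ j) = 0"
      using S [of "[i, i, i, j]"] S [of "[i, i, j, j]"] S [of "[i, j, j, j]"] d
      by (simp_all add: axis_def power2_eq_square power3_eq_cube algebra_simps)
    \<comment> \<open>Comparing the monomials iiij and ijjj cancels \<open>Add2\<close> and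
      \<open>Diff2\<close>. The factor x_i^2 - x_j^2 is what requires x_i to differ from both x_j
      and - x_j.\<close>
    then have "?\<gamma> * (x $ i * x $ j * (x $ i - x $ j) * (x $ i + x $ j)) = 0" by algebra
    moreover have "x $ i + x $ j \<noteq> 0" using ne(2) [OF d] by (simp add: eq_neg_iff_add_eq_0)
    ultimately have "?\<gamma> = 0" using ne(1) [OF d] nz by simp
    with e show ?thesis by algebra
  qed
  then have pair': "a \<notin> {Add2 i j, Diff2 i j, Mult2 i j}" if "a \<in> WB_index" "c a \<noteq> 0" for a i j
    using that by (auto simp: WB_index_def)
  have "c (Coord i) = 0" for i
  proof -
    have "(\<Sum>a\<in>{Coord i}. c a * (\<Prod>p\<leftarrow>[i, i, i, i]. WB_grad a x $ p)) = 0"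
    proof (rule power_relation_support [OF R])
      fix a assume "a \<in> WB_index" "c a \<noteq> 0" "set [i, i, i, i] \<subseteq> WB_support a"
      then show "a \<in> {Coord i}" using WB_support_1 [of i a] Mult4' triple' pair' by auto
    qed (auto simp: WB_index_def)
    then show ?thesis by (simp add: axis_def)
  qed
  with Mult4 triple pair a show ?thesis by (auto simp: WB_index_def)
qed

text \<open>If the differential of \<open>a\<close> vanished, the indicator of \<open>a\<close>
  would be a nontrivial relation among fourth powers.\<close>

lemma WB_grad_nonzero:
  assumes "x \<in> WB_locus" "a \<in> WB_index"
  obtains p where "WB_grad a x $ p \<noteq> 0"
proof (cases "\<exists>p. WB_grad a x $ p \<noteq> 0")
  case False
  then have "power_relation WB_index (\<lambda>a. WB_grad a x) 4 (\<lambda>b. if b = a then 1 else 0)"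
    unfolding power_relation_def
    by (simp add: length_Suc_conv eval_nat_numeral if_distrib [of "\<lambda>c. c * _"] sum.delta finite_WB_index cong: if_cong) auto
  from power_relation_4_imp_0 [OF assms(1) this assms(2)] show ?thesis by simp
qed (use that in blast)

lemma power_relation_high_imp_0:
  fixes c :: "'n::{finite,linorder} wb_index \<Rightarrow> complex"
  assumes x: "x \<in> WB_locus" and R: "power_relation WB_index (\<lambda>a. WB_grad a x) h c"
    and "4 \<le> h" and a: "a \<in> WB_index"
  shows "c a = 0"
proof -
  obtain p where p: "WB_grad a x $ p \<noteq> 0" using WB_grad_nonzero [OF x a] .
  \<comment> \<open>Multiplying every test monomial of degree 4 by the power p^(h-4) gives a
    relation of degree 4. The variable \<open>p\<close> is adapted to the one function
    \<open>a\<close> only, so the conclusion is drawn for \<open>a\<close> alone.\<close>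
  define d where "d b = c b * WB_grad b x $ p ^ (h - 4)" for b
  have "power_relation WB_index (\<lambda>a. WB_grad a x) 4 d"
    unfolding power_relation_def
  proof (intro allI impI)
    fix ps :: "'n list" assume "length ps = 4"
    then have "length (replicate (h - 4) p @ ps) = h" using \<open>4 \<le> h\<close> by simp
    from power_relationD [OF R this] show "(\<Sum>a\<in>WB_index. d a * (\<Prod>p\<leftarrow>ps. WB_grad a x $ p)) = 0"
      by (simp add: d_def mult.assoc)
  qed
  from power_relation_4_imp_0 [OF x this a] p show ?thesis by (simp add: d_def)
qed

text \<open>The same elimination within \<open>WB_low h\<close>, again with square blocks. Their
  entries are constants 1 and -1, whence no condition on \<open>x\<close>.\<close>

lemma power_relation_low_imp_0:
  fixes c :: "'n::{finite,linorder} wb_index \<Rightarrow> complex"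
  assumes R: "power_relation WB_index (\<lambda>a. WB_grad a x) h c"
    and h: "h \<in> {1, 2, 3}" and c: "\<And>a. a \<in> WB_index - WB_low h \<Longrightarrow> c a = 0" and a: "a \<in> WB_index"
  shows "c a = 0"
proof -
  have low: "a \<in> WB_low h" if "a \<in> WB_index" "c a \<noteq> 0" for a
    using c that by blast
  have Add3: "c (Add3 i j k) = 0" if "i < j" "j < k" for i j k
  proof (cases "h = 3")
    case True
    have "(\<Sum>a\<in>{Add3 i j k}. c a * (\<Prod>p\<leftarrow>[i, j, k]. WB_grad a x $ p)) = 0"
    proof (rule power_relation_support [OF R])
      fix a assume "a \<in> WB_index" "c a \<noteq> 0" "set [i, j, k] \<subseteq> WB_support a"
      then show "a \<in> {Add3 i j k}"
        using low [of a] WB_support_3 [OF that, of a] by (auto simp: WB_low_def split: if_splits)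
    qed (use that True in \<open>auto simp: WB_index_def\<close>)
    moreover have "i \<noteq> j" "i \<noteq> k" "j \<noteq> k" using that by auto
    ultimately show ?thesis by (simp add: axis_def)
  next
    case False
    then show ?thesis using low [of "Add3 i j k"] that h
      by (cases "c (Add3 i j k) = 0") (auto simp: WB_low_def WB_index_def split: if_splits)
  qed
  have low': "a \<in> range Coord \<or> (\<exists>i j. i < j \<and> a \<in> {Add2 i j, Diff2 i j})"
    if "a \<in> WB_index" "c a \<noteq> 0" for a
    using low [OF that] that Add3 by (auto simp: WB_low_def split: if_splits)
  have pair: "c (Add2 i j) = 0 \<and> c (Diff2 i j) = 0" if "i < j" for i j
  proof -
    have S: "(\<Sum>a\<in>{Add2 i j, Diff2 i j}. c a * (\<Prod>p\<leftarrow>ps. WB_grad a x $ p)) = 0"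
      if "length ps = h" "set ps = {i, j}" for ps
    proof (rule power_relation_support [OF R])
      fix a assume "a \<in> WB_index" "c a \<noteq> 0" "set ps \<subseteq> WB_support a"
      then show "a \<in> {Add2 i j, Diff2 i j}"
        using that low' [of a] \<open>i < j\<close> by auto
    qed (use that \<open>i < j\<close> in \<open>auto simp: WB_index_def\<close>)
    have d: "i \<noteq> j" using that by auto
    consider "h = 1" | "h = 2" | "h = 3" using h by blast
    then show ?thesis
    proof cases
      case 1
      then show ?thesis
        using low [of "Add2 i j"] low [of "Diff2 i j"] that by (auto simp: WB_low_def WB_index_def)
    next
      case 2
      then have "c (Diff2 i j) = 0" using low [of "Diff2 i j"] that by (auto simp: WB_low_def WB_index_def)
      then show ?thesis using S [of "[i, j]"] 2 d by (simp add: axis_def)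
    next
      case 3
      \<comment> \<open>The form of \<open>Diff2 i j\<close> is -1 at i and 1 at j, so its sign is
        the parity of the exponent of i: plus on iij, minus on ijj.\<close>
      then have "c (Add2 i j) + c (Diff2 i j) = 0" "c (Add2 i j) - c (Diff2 i j) = 0"
        using S [of "[i, i, j]"] S [of "[i, j, j]"] d by (auto simp: axis_def)
      then show ?thesis by algebra
    qed
  qed
  have "c (Coord i) = 0" for i
  proof -
    have "(\<Sum>a\<in>{Coord i}. c a * (\<Prod>p\<leftarrow>replicate h i. WB_grad a x $ p)) = 0"
    proof (rule power_relation_support [OF R])
      fix a assume "a \<in> WB_index" "c a \<noteq> 0" "set (replicate h i) \<subseteq> WB_support a"
      then show "a \<in> {Coord i}"
        using low' [of a] pair h by auto
    qed (auto simp: WB_index_def)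
    then show ?thesis by (simp add: axis_def)
  qed
  with pair show ?thesis using low' [OF a] by (cases "c a = 0") auto
qed

section \<open>Regular locus and ordinarity\<close>

lemma differential_WB: "differential (WB a) x = WB_grad a x"
  by (rule has_grad_differential [OF has_grad_WB])

lemma holo_on_WB: "holo_on (WB a) U"
  unfolding holo_on_iff_has_grad using has_grad_WB by blast

lemma form_ker_scale: "c \<noteq> 0 \<Longrightarrow> form_ker (c *s v) = form_ker v"
  by (simp add: form_ker_def mult.assoc sum_distrib_left [symmetric])

lemma form_ker_axis: "form_ker (axis i 1) = {v. v $ i = 0}"
  by (simp add: form_ker_def axis_def if_distrib [of "\<lambda>c. c * _"] cong: if_cong)

text \<open>The vectors a_p e_i - a_i e_p lie in the kernel of \<open>a\<close>; evaluating
  \<open>b\<close> on them gives the proportionality.\<close>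

lemma form_ker_subset_imp_scale:
  assumes "form_ker a \<subseteq> form_ker b" "a $ p \<noteq> 0"
  shows "b = (b $ p / a $ p) *s a"
proof -
  have sum: "(\<Sum>l\<in>UNIV. f $ l * (s *s axis i 1 - t *s axis j 1) $ l) = f $ i * s - f $ j * t"
    for f :: "complex ^ 'n" and s t i j
    by (simp add: right_diff_distrib sum_subtractf axis_def if_distrib [of "\<lambda>c. _ * c"] cong: if_cong)
  have "b $ i * a $ p = b $ p * a $ i" for i
  proof -
    have "a $ p *s axis i 1 - a $ i *s axis p 1 \<in> form_ker a"
      unfolding form_ker_def mem_Collect_eq sum by simp
    then have "a $ p *s axis i 1 - a $ i *s axis p 1 \<in> form_ker b" using assms(1) by blast
    then show ?thesis unfolding form_ker_def mem_Collect_eq sum by simp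
  qed
  then show ?thesis using assms(2) by (simp add: vec_eq_iff field_simps)
qed

text \<open>Off \<open>WB_locus\<close> the form d(x_i x_j) vanishes or becomes proportional to
  dx_i, dx_j, d(x_i + x_j) or d(x_j - x_i). On \<open>WB_locus\<close> two proportional
  differentials would yield a nontrivial relation among fourth powers.\<close>

lemma regular_locus_WB:
  assumes "CARD('n::{finite,linorder}) \<ge> 2"
  shows "regular_locus (WB_index :: 'n wb_index set) WB = WB_locus"
proof (intro equalityI subsetI)
  fix x :: "(complex, 'n) vec" assume x: "x \<in> regular_locus WB_index WB"
  have nz: "WB_grad a x \<noteq> 0" if "a \<in> WB_index" for a
    using x that by (auto simp: regular_locus_def differential_WB)
  have ker: "a = b" if "WB_grad a x = c *s WB_grad b x" "c \<noteq> 0" "a \<in> WB_index" "b \<in> WB_index" for a b c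
    using x that form_ker_scale [OF that(2)] unfolding regular_locus_def differential_WB by fastforce
  have pair: "x $ i \<noteq> 0 \<and> x $ j \<noteq> 0 \<and> x $ i \<noteq> x $ j \<and> x $ i \<noteq> - x $ j" if "i < j" for i j
  proof -
    have I: "Mult2 i j \<in> WB_index" "Add2 i j \<in> WB_index" "Diff2 i j \<in> WB_index"
      "Coord i \<in> WB_index" "Coord j \<in> WB_index"
      using that by (auto simp: WB_index_def)
    have i: "x $ i \<noteq> 0"
    proof
      assume "x $ i = 0"
      then show False using nz [OF I(1)] ker [of "Mult2 i j" "x $ j" "Coord i"] I by auto
    qed
    have j: "x $ j \<noteq> 0"
    proof
      assume "x $ j = 0"
      then show False using nz [OF I(1)] ker [of "Mult2 i j" "x $ i" "Coord j"] I by auto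
    qed
    have "x $ i \<noteq> x $ j"
    proof
      assume "x $ i = x $ j"
      then have "WB_grad (Mult2 i j) x = x $ i *s WB_grad (Add2 i j) x"
        by (simp add: vec_eq_iff algebra_simps)
      then show False using ker I i by blast
    qed
    moreover have "x $ i \<noteq> - x $ j"
    proof
      assume "x $ i = - x $ j"
      then have "WB_grad (Mult2 i j) x = x $ i *s WB_grad (Diff2 i j) x"
        by (simp add: vec_eq_iff algebra_simps)
      then show False using ker I i by blast
    qed
    ultimately show ?thesis using i j by blast
  qed
  \<comment> \<open>Every coordinate must belong to a pair for the products to force it to be
    nonzero; here n must be at least 2.\<close>
  have "\<exists>j. j \<noteq> i" for i :: 'n
  proof (rule ccontr)
    assume "\<nexists>j. j \<noteq> i"
    then have "UNIV = {i}" by auto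
    then have "CARD('n) = 1" by (metis card.empty card_insert_disjoint empty_iff finite.emptyI One_nat_def)
    with assms show False by simp
  qed
  then have "x $ i \<noteq> 0" for i using pair by (metis linorder_neqE)
  moreover have "x $ i \<noteq> x $ j \<and> x $ i \<noteq> - x $ j" if "i \<noteq> j" for i j
    using pair [of i j] pair [of j i] that by (cases i j rule: linorder_cases) (auto simp: minus_equation_iff)
  ultimately show "x \<in> WB_locus" by (auto simp: WB_locus_def)
next
  fix x :: "(complex, 'n) vec" assume x: "x \<in> WB_locus"
  have "a = b" if a: "a \<in> WB_index" and b: "b \<in> WB_index"
    and ker: "form_ker (WB_grad a x) = form_ker (WB_grad b x)" for a b
  proof (rule ccontr)
    assume "a \<noteq> b"
    obtain p where "WB_grad a x $ p \<noteq> 0" using WB_grad_nonzero [OF x a] .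
    then obtain k where k: "WB_grad b x = k *s WB_grad a x"
      using form_ker_subset_imp_scale ker by (metis order_refl)
    \<comment> \<open>If the second form is k times the first, then k^4 times the fourth power of
      the first minus the fourth power of the second is zero.\<close>
    define c where "c d = (if d = a then k ^ 4 else if d = b then - 1 else 0)" for d
    have "(\<Prod>p\<leftarrow>ps. (k *s v) $ p) = k ^ length ps * (\<Prod>p\<leftarrow>ps. v $ p)" for ps and v :: "(complex, 'n) vec"
      by (induction ps) auto
    then have "power_relation {a, b} (\<lambda>a. WB_grad a x) 4 c"
      using \<open>a \<noteq> b\<close> by (simp add: power_relation_def k c_def del: vector_smult_component)
    then have "power_relation WB_index (\<lambda>a. WB_grad a x) 4 c"
      using power_relation_restrict [OF finite_WB_index, of "{a, b}" c] a b by (auto simp: c_def)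
    from power_relation_4_imp_0 [OF x this b] \<open>a \<noteq> b\<close> show False by (simp add: c_def)
  qed
  moreover have "WB_grad a x \<noteq> 0" if "a \<in> WB_index" for a
    using WB_grad_nonzero [OF x that] by (metis zero_index)
  ultimately show "x \<in> regular_locus WB_index WB"
    unfolding regular_locus_def differential_WB by blast
qed

lemma open_WB_locus: "open (WB_locus :: (complex ^ 'n) set)"
proof -
  have "WB_locus = (\<Inter>i. {x :: complex ^ 'n. x $ i \<noteq> 0}) \<inter>
      (\<Inter>i. \<Inter>j\<in>- {i}. {x. x $ i \<noteq> x $ j} \<inter> {x. x $ i \<noteq> - x $ j})"
    by (auto simp: WB_locus_def)
  then show ?thesis
    by (elim ssubst) (intro open_Int open_INT finite ballI open_Collect_neq continuous_intros)
qed

text \<open>The point (1, ..., n). Distinct positive coordinates put it into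
  \<open>WB_locus\<close>; the increasing order makes the differences x_j - x_i with i < j positive
  as well. It also serves as a direction for the density argument.\<close>

definition WB_point :: "complex ^ 'n::{finite,linorder}" where
  "WB_point = (\<chi> i. of_nat (Suc (card {j. j < i})))"

lemma WB_point_less:
  "i < j \<Longrightarrow> card {l. l < i} < card {l :: 'n::{finite,linorder}. l < j}"
  by (rule psubset_card_mono) auto

lemma WB_point_in_locus: "(WB_point :: complex ^ 'n::{finite,linorder}) \<in> WB_locus"
proof -
  have "card {l. l < i} \<noteq> card {l. l < j}" if "i \<noteq> j" for i j :: 'n
    using that WB_point_less [of i j] WB_point_less [of j i] by (cases i j rule: linorder_cases) auto
  moreover have "of_nat (Suc k) \<noteq> - (of_nat (Suc l) :: complex)" for k l
  proof
    assume "of_nat (Suc k) = - (of_nat (Suc l) :: complex)"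
    then have "of_nat (Suc k + Suc l) = (0 :: complex)" unfolding of_nat_add by (simp only: eq_neg_iff_add_eq_0)
    then show False unfolding of_nat_eq_0_iff by simp
  qed
  ultimately show ?thesis
    unfolding WB_locus_def WB_point_def by (simp del: of_nat_Suc)
qed

text \<open>On the line through any point in the direction \<open>WB_point\<close>, each condition
  defining the locus is affine in t with nonzero slope, so it fails for at most one t.\<close>

lemma closure_WB_locus: "closure (WB_locus :: (complex ^ 'n::{finite,linorder}) set) = UNIV"
proof -
  let ?w = "WB_point :: (complex, 'n) vec"
  have affine: "\<forall>\<^sub>F t in at 0. a + t * b \<noteq> 0" if "b \<noteq> 0" for a b :: complex
  proof (rule eventually_mono [OF eventually_neq_at_within [of "- a / b"]])
    fix t assume "t \<noteq> - a / b"
    then show "a + t * b \<noteq> 0" using that by (auto simp: field_simps add_eq_0_iff2)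
  qed
  have w: "?w $ i \<noteq> 0" "i \<noteq> j \<Longrightarrow> ?w $ i - ?w $ j \<noteq> 0" "i \<noteq> j \<Longrightarrow> ?w $ i + ?w $ j \<noteq> 0" for i j
    using WB_point_in_locus [where 'n='n] by (auto simp: WB_locus_def add_eq_0_iff2)
  have "x \<in> closure WB_locus" for x :: "(complex, 'n) vec"
  proof (rule Lim_in_closed_set [OF closed_closure])
    have "\<forall>\<^sub>F t in at 0. \<forall>i. x $ i + t * ?w $ i \<noteq> 0"
      by (intro eventually_all_finite affine w)
    moreover have "\<forall>\<^sub>F t in at 0. \<forall>i j. i \<noteq> j \<longrightarrow> (x $ i - x $ j) + t * (?w $ i - ?w $ j) \<noteq> 0"
      by (intro eventually_all_finite) (use affine w(2) in \<open>auto intro: eventually_mono\<close>)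
    moreover have "\<forall>\<^sub>F t in at 0. \<forall>i j. i \<noteq> j \<longrightarrow> (x $ i + x $ j) + t * (?w $ i + ?w $ j) \<noteq> 0"
      by (intro eventually_all_finite) (use affine w(3) in \<open>auto intro: eventually_mono\<close>)
    ultimately have "\<forall>\<^sub>F t in at 0. x + t *s ?w \<in> WB_locus"
    proof eventually_elim
      case (elim t)
      have "(x + t *s ?w) $ i \<noteq> (x + t *s ?w) $ j" "(x + t *s ?w) $ i \<noteq> - (x + t *s ?w) $ j" if "i \<noteq> j" for i j
      proof -
        have "(x + t *s ?w) $ i - (x + t *s ?w) $ j = (x $ i - x $ j) + t * (?w $ i - ?w $ j)"
          "(x + t *s ?w) $ i + (x + t *s ?w) $ j = (x $ i + x $ j) + t * (?w $ i + ?w $ j)"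
          by (simp_all add: algebra_simps)
        then show "(x + t *s ?w) $ i \<noteq> (x + t *s ?w) $ j" "(x + t *s ?w) $ i \<noteq> - (x + t *s ?w) $ j"
          using elim(2,3) that by (metis right_minus_eq, metis eq_neg_iff_add_eq_0)
      qed
      then show ?case using elim(1) by (simp add: WB_locus_def)
    qed
    then show "\<forall>\<^sub>F t in at 0. x + t *s ?w \<in> closure WB_locus"
      by (rule eventually_mono) (use closure_subset in blast)
    show "((\<lambda>t. x + t *s ?w) \<longlongrightarrow> x) (at 0)"
    proof (rule vec_tendstoI)
      fix i
      have "((\<lambda>t. x $ i + t * ?w $ i) \<longlongrightarrow> x $ i + 0 * ?w $ i) (at 0)"
        by (intro tendsto_intros)
      then show "((\<lambda>t. (x + t *s ?w) $ i) \<longlongrightarrow> x $ i) (at 0)" by simp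
    qed
  qed simp
  then show ?thesis by blast
qed

lemma is_web_WB:
  assumes "CARD('n::{finite,linorder}) \<ge> 2"
  shows "is_web (cdim CARD('n) 4) (WB_index :: 'n wb_index set) WB"
  unfolding is_web_def regular_locus_WB [OF assms]
proof (intro conjI ballI)
  show "card (WB_index :: 'n wb_index set) = cdim CARD('n) 4"
    using assms by (simp add: card_WB_index cdim_low)
  fix x :: "(complex, 'n) vec"
  have "(\<Inter>i\<in>range Coord. form_ker (differential (WB i) x)) = {0}"
    by (auto simp: differential_WB form_ker_axis vec_eq_iff)
  then show "\<exists>J\<subseteq>WB_index. card J = CARD('n) \<and> (\<Inter>i\<in>J. form_ker (differential (WB i) x)) = {0}"
    using card_Coord by (intro exI [of _ "range Coord"]) (auto simp: WB_index_def)
qed (simp_all add: finite_WB_index holo_on_WB open_WB_locus closure_WB_locus)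

section \<open>Ranks of the matrices P_h\<close>

lemma sum_fun_apply: "(\<Sum>a\<in>A. f a) x = (\<Sum>a\<in>A. f a x :: complex)"
  by (induction A rule: infinite_finite_induct) auto

text \<open>\<open>P_rank\<close> is computed from the set of columns, in which equal columns would
  merge; the absence of relations between indexed columns excludes this too.\<close>

lemma cfun_independent_image:
  fixes V :: "'i \<Rightarrow> 'b \<Rightarrow> complex"
  assumes "finite B"
    and ind: "\<forall>c. (\<forall>K. (\<Sum>a\<in>B. c a * V a K) = 0) \<longrightarrow> (\<forall>a\<in>B. c a = 0)"
  shows "inj_on V B" "cfun.independent (V ` B)"
proof -
  show inj: "inj_on V B"
  proof (rule inj_onI, rule ccontr)
    fix a b assume ab: "a \<in> B" "b \<in> B" "V a = V b" "a \<noteq> b"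
    let ?c = "\<lambda>d. if d = a then 1 else if d = b then - 1 else 0 :: complex"
    have "(\<Sum>d\<in>B. ?c d * V d K) = (\<Sum>d\<in>{a, b}. ?c d * V d K)" for K
      using ab assms(1) by (intro sum.mono_neutral_right) auto
    then have "(\<Sum>d\<in>B. ?c d * V d K) = 0" for K using ab by simp
    with spec [OF ind, of ?c] ab(1) show False by force
  qed
  show "cfun.independent (V ` B)"
  proof
    assume "cfun.dependent (V ` B)"
    then obtain u where u: "\<exists>v\<in>V ` B. u v \<noteq> 0" "(\<Sum>v\<in>V ` B. (\<lambda>x. u v * v x)) = 0"
      using cfun.dependent_finite assms(1) by blast
    have "(\<Sum>a\<in>B. u (V a) * V a K) = 0" for K
      using fun_cong [OF u(2), of K] by (simp add: sum_fun_apply sum.reindex [OF inj])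
    with spec [OF ind, of "\<lambda>a. u (V a)"] u(1) show False by blast
  qed
qed

text \<open>For h at least 4 all columns are independent. For smaller h the columns of
  \<open>WB_low h\<close> bound the rank below, and the number of nonzero rows bounds it above by
  the same c(n,h).\<close>

lemma P_rank_WB:
  fixes x :: "complex ^ 'n::{finite,linorder}"
  assumes n: "CARD('n) \<ge> 2" and x: "x \<in> WB_locus" and h: "h \<ge> 1"
  shows "P_rank WB_index WB h x = min (card (WB_index :: 'n wb_index set)) (cdim CARD('n) h)"
proof -
  let ?V = "P_column WB h x"
  have rel: "power_relation WB_index (\<lambda>a. WB_grad a x) h c"
    if "\<And>K. (\<Sum>a\<in>WB_index. c a * ?V a K) = 0" for c
    by (rule power_relation_P_column [of _ WB x]) (simp_all add: differential_WB that)
  have card: "card (WB_index :: 'n wb_index set) = cdim CARD('n) 4"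
    using n by (simp add: card_WB_index cdim_low)
  show ?thesis
  proof (cases "h \<ge> 4")
    case True
    have "c a = 0" if "\<And>K. (\<Sum>a\<in>WB_index. c a * ?V a K) = 0" "a \<in> WB_index" for c a
      using power_relation_high_imp_0 [OF x rel [OF that(1)] True that(2)] .
    then have "inj_on ?V WB_index \<and> cfun.independent (?V ` WB_index)"
      by (intro conjI cfun_independent_image finite_WB_index) blast+
    then have "P_rank WB_index WB h x = card (WB_index :: 'n wb_index set)"
      unfolding P_rank_def by (simp add: cfun.dim_eq_card_independent card_image)
    then show ?thesis using card cdim_mono [OF n True] by simp
  next
    case False
    then have h': "h \<in> {1, 2, 3}" using h by auto
    let ?B = "WB_low h :: 'n wb_index set"
    have finB: "finite ?B" using WB_low_subset finite_WB_index by (rule finite_subset)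
    have "c a = 0" if c: "\<And>K. (\<Sum>a\<in>?B. c a * ?V a K) = 0" and a: "a \<in> ?B" for c a
    proof -
      define d where "d a = (if a \<in> ?B then c a else 0)" for a
      have "(\<Sum>a\<in>WB_index. d a * ?V a K) = (\<Sum>a\<in>?B. d a * ?V a K)" for K
        by (rule sum.mono_neutral_right [OF finite_WB_index WB_low_subset]) (auto simp: d_def)
      then have "(\<Sum>a\<in>WB_index. d a * ?V a K) = 0" for K
        using c [of K] by (simp add: d_def cong: sum.cong)
      from power_relation_low_imp_0 [OF rel [OF this] h', of a] a WB_low_subset
      show ?thesis by (auto simp: d_def)
    qed
    then have B: "inj_on ?V ?B \<and> cfun.independent (?V ` ?B)"
      by (intro conjI cfun_independent_image finB) blast+
    obtain C where C: "?V ` ?B \<subseteq> C" "C \<subseteq> ?V ` WB_index" "cfun.independent C" "?V ` WB_index \<subseteq> cfun.span C"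
      using cfun.maximal_independent_subset_extend [OF image_mono [OF WB_low_subset] conjunct2 [OF B]] .
    have "cdim CARD('n) h = card (?V ` ?B)" using card_WB_low [OF h', where 'n='n] card_image [OF conjunct1 [OF B]] by simp
    also have "\<dots> \<le> card C"
      using C finite_WB_index by (intro card_mono) (auto intro: finite_subset)
    also have "\<dots> = P_rank WB_index WB h x"
      unfolding P_rank_def using C by (intro cfun.basis_card_eq_dim)
    finally have le: "cdim CARD('n) h \<le> P_rank WB_index WB h x" .
    let ?M = "{K :: 'n \<Rightarrow> nat. (\<Sum>l\<in>UNIV. K l) = h}"
    let ?\<delta> = "\<lambda>K L. if L = K then 1 else 0 :: complex"
    have cM: "card ?M = cdim CARD('n) h" by (rule card_multi_indices)
    \<comment> \<open>An infinite set has \<open>card\<close> 0, so a positive count yields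
      finiteness.\<close>
    have "cdim CARD('n) h > 0" using n by (auto simp: cdim_binomial)
    then have finM: "finite ?M" using cM card_ge_0_finite by metis
    have "?V a \<in> cfun.span (?\<delta> ` ?M)" for a
    proof -
      have "?V a = (\<Sum>K\<in>?M. (\<lambda>L. ?V a K * ?\<delta> K L))"
      proof
        fix L
        have "(\<Sum>K\<in>?M. ?V a K * ?\<delta> K L) = (\<Sum>K\<in>?M. if L = K then ?V a K else 0)"
          by (rule sum.cong) simp_all
        also have "\<dots> = (if L \<in> ?M then ?V a L else 0)"
          by (rule sum.delta' [OF finM])
        also have "\<dots> = ?V a L" by (simp add: P_column_def)
        finally show "?V a L = (\<Sum>K\<in>?M. (\<lambda>L. ?V a K * ?\<delta> K L)) L"
          by (simp only: sum_fun_apply)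
      qed
      also have "\<dots> \<in> cfun.span (?\<delta> ` ?M)"
        by (intro cfun.span_sum cfun.span_scale cfun.span_base) auto
      finally show ?thesis .
    qed
    then have "P_rank WB_index WB h x \<le> card (?\<delta> ` ?M)"
      unfolding P_rank_def using finM by (intro cfun.dim_le_card) auto
    also have "\<dots> \<le> cdim CARD('n) h" using card_image_le [OF finM] cM by metis
    finally show ?thesis using le card cdim_mono [OF n, of h 4] False by simp
  qed
qed

lemma ordinary_WB:
  assumes "CARD('n::{finite,linorder}) \<ge> 2"
  shows "ordinary (WB_index :: 'n wb_index set) WB"
  unfolding ordinary_def regular_locus_WB [OF assms]
proof (intro exI [of _ "{}"] conjI ballI allI impI)
  have "holo_on (\<lambda>_. 1) (WB_locus :: ((complex, 'n) vec) set)"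
    unfolding holo_on_iff_has_grad using has_grad_const by blast
  then have "\<exists>W F. open W \<and> p \<in> W \<and> W \<subseteq> WB_locus \<and> finite F \<and> (\<forall>f\<in>F. holo_on f W) \<and>
        {} \<inter> W = {x \<in> W. \<forall>f\<in>F. f x = 0}" if "p \<in> WB_locus" for p :: "(complex, 'n) vec"
    \<comment> \<open>The empty set is the zero set of the constant function 1.\<close>
    using that open_WB_locus by (intro exI [of _ WB_locus] exI [of _ "{\<lambda>_. 1}"]) auto
  then show "analytic_subset (WB_locus :: ((complex, 'n) vec) set) {}"
    unfolding analytic_subset_def by blast
  show "dim_at_most ({} :: ((complex, 'n) vec) set) (CARD('n) - 1)"
    by (simp add: dim_at_most_def regular_point_def)
qed (use P_rank_WB [OF assms] in auto)

section \<open>Upper bound for the rank\<close>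

lemma has_grad_transform:
  assumes "has_grad f F x" "open S" "x \<in> S" "\<And>y. y \<in> S \<Longrightarrow> f y = g y"
  shows "has_grad g F x"
  using has_derivative_transform_within_open [OF assms(1) [unfolded has_grad_def] assms(2-4)]
  by (simp add: has_grad_def)

lemma has_grad_imp_continuous_on:
  "(\<And>x. x \<in> S \<Longrightarrow> \<exists>F. has_grad f F x) \<Longrightarrow> continuous_on S f"
  by (meson continuous_at_imp_continuous_on has_grad_imp_isCont)

text \<open>Straightening \<open>u\<close> to a coordinate by the inverse function theorem, the closed form is
  \<open>\<lambda> du\<close> with \<open>d\<lambda> \<and> du = 0\<close>, so \<open>\<lambda>\<close> depends on that coordinate only.\<close>

lemma closed_form_factors_through_first_integral:
  fixes u :: "complex ^ 'n \<Rightarrow> complex" and \<omega> G :: "complex ^ 'n \<Rightarrow> complex ^ 'n"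
  assumes U: "open U" "m \<in> U"
    and u: "\<And>x. x \<in> U \<Longrightarrow> has_grad u (G x) x"
    and G: "\<And>x. x \<in> U \<Longrightarrow> \<exists>H. (\<forall>k. has_grad (\<lambda>y. G y $ k) (H k) x) \<and> (\<forall>k l. H k $ l = H l $ k)"
    and p: "G m $ p \<noteq> 0"
    and \<omega>: "\<And>l. holo_on (\<lambda>x. \<omega> x $ l) U"
    and closed: "\<And>x k l. x \<in> U \<Longrightarrow> partial (\<lambda>y. \<omega> y $ k) l x = partial (\<lambda>y. \<omega> y $ l) k x"
    and ker: "\<And>x. x \<in> U \<Longrightarrow> form_ker (G x) \<subseteq> form_ker (\<omega> x)"
  obtains f r where "r > 0" "f holomorphic_on ball (u m) r"
    "\<forall>\<^sub>F x in nhds m. u x \<in> ball (u m) r \<and> \<omega> x = f (u x) *s G x"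
proof -
  let ?e = "axis p 1 :: complex ^ 'n"
  define W where "W = {x \<in> U. G x $ p \<noteq> 0}"
  have contG: "continuous_on U (\<lambda>x. G x $ l)" for l
    using G by (intro has_grad_imp_continuous_on) blast
  have "W = U \<inter> (\<lambda>x. G x $ p) -` (- {0})" by (auto simp: W_def)
  then have W: "open W" "W \<subseteq> U" "m \<in> W"
    using continuous_open_preimage [OF contG U(1), of "- {0}" p] U(2) p by (auto simp: W_def)
  define lam where "lam x = \<omega> x $ p * inverse (G x $ p)" for x
  have lam: "\<omega> x = lam x *s G x" if "x \<in> W" for x
    using form_ker_subset_imp_scale [OF ker, of x p] that unfolding W_def lam_def by (simp add: divide_inverse)
  have grad_lam: "\<exists>\<Lambda>. has_grad lam \<Lambda> x" if x: "x \<in> W" for x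
  proof -
    obtain F H where F: "has_grad (\<lambda>x. \<omega> x $ p) F x" and H: "has_grad (\<lambda>x. G x $ p) H x"
      using \<omega> [of p] G [of x] W(2) x unfolding holo_on_iff_has_grad by blast
    have "(inverse has_field_derivative - (inverse (G x $ p) ^ Suc (Suc 0))) (at (G x $ p))"
      using x by (intro DERIV_inverse) (simp add: W_def)
    from has_grad_mult [OF F has_grad_compose [OF H this]] show ?thesis
      unfolding lam_def by blast
  qed
  have lam_ker: "(\<Sum>l\<in>UNIV. \<Lambda> $ l * v $ l) = 0"
    if x: "x \<in> W" and \<Lambda>: "has_grad lam \<Lambda> x" and v: "(\<Sum>l\<in>UNIV. G x $ l * v $ l) = 0" for x \<Lambda> v
  proof -
    obtain H where H: "\<And>k. has_grad (\<lambda>y. G y $ k) (H k) x" "\<And>k l. H k $ l = H l $ k"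
      using G [of x] x W(2) by blast
    have "has_grad (\<lambda>y. \<omega> y $ k) (lam x *s H k + G x $ k *s \<Lambda>) x" for k
      by (rule has_grad_transform [OF has_grad_mult [OF \<Lambda> H(1)] W(1) x]) (simp add: lam)
    note part = has_grad_partial [OF this]
    \<comment> \<open>In the closedness equation the terms with \<open>lam x\<close> cancel by
      symmetry of the second derivatives; what remains says that \<open>\<Lambda>\<close> is
      proportional to \<open>G x\<close>.\<close>
    have "G x $ l * \<Lambda> $ p = G x $ p * \<Lambda> $ l" for l
      using closed [of x l p] x W(2) H(2) [of l p] unfolding part by auto
    then have "G x $ p * (\<Sum>l\<in>UNIV. \<Lambda> $ l * v $ l) = \<Lambda> $ p * (\<Sum>l\<in>UNIV. G x $ l * v $ l)"
      by (simp add: sum_distrib_left mult.assoc [symmetric]) (simp add: mult.commute)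
    then show ?thesis using v x by (simp add: W_def)
  qed
  \<comment> \<open>The map replaces the p-th coordinate by u; it is locally invertible since the
    p-th partial derivative of u is nonzero.\<close>
  define \<Phi> where "\<Phi> x = x + (u x - x $ p) *s ?e" for x
  define D where "D x v = v + ((\<Sum>l\<in>UNIV. G x $ l * v $ l) - v $ p) *s ?e" for x v
  have \<Phi>p: "\<Phi> x $ p = u x" for x by (simp add: \<Phi>_def)
  have Dp: "D x v $ p = (\<Sum>l\<in>UNIV. G x $ l * v $ l)" for x v by (simp add: D_def)
  have D_scale: "D x (c *s v) = c *s D x v" for x c v
    by (simp add: D_def vec_eq_iff sum_distrib_left algebra_simps)
  have der\<Phi>: "(\<Phi> has_derivative D x) (at x)" if "x \<in> W" for x
    unfolding \<Phi>_def D_def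
    using u [of x] that W(2) unfolding has_grad_def
    by (intro has_derivative_add has_derivative_ident bounded_linear.has_derivative [OF bounded_linear_vector_smult]
        has_derivative_diff bounded_linear_imp_has_derivative bounded_linear_vec_nth) auto
  then have blD: "bounded_linear (D x)" if "x \<in> W" for x
    using that has_derivative_bounded_linear by blast
  then have BD: "blinfun_apply (Blinfun (D x)) = D x" if "x \<in> W" for x
    using that bounded_linear_Blinfun_apply by blast
  \<comment> \<open>Inverse of \<open>D m\<close>: that map replaces the p-th coordinate of v by
    du(v), and v_p is recovered by dividing by \<open>G m $ p\<close>.\<close>
  define E where "E w = w + ((w $ p - (\<Sum>l\<in>UNIV. G m $ l * w $ l)) / G m $ p) *s ?e" for w
  have ED: "E (D m v) = v" for v
  proof -
    have "(\<Sum>l\<in>UNIV. G m $ l * D m v $ l) =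
        (\<Sum>l\<in>UNIV. G m $ l * v $ l) + ((\<Sum>l\<in>UNIV. G m $ l * v $ l) - v $ p) * G m $ p"
    proof -
      have "(\<Sum>l\<in>UNIV. G m $ l * (c *s ?e) $ l) = (\<Sum>l\<in>UNIV. if l = p then c * G m $ p else 0)" for c
        by (rule sum.cong) (auto simp: axis_def)
      then have "(\<Sum>l\<in>UNIV. G m $ l * (c *s ?e) $ l) = c * G m $ p" for c
        by simp
      then show ?thesis unfolding D_def vector_add_component distrib_left sum.distrib by (simp only:)
    qed
    then have "(D m v $ p - (\<Sum>l\<in>UNIV. G m $ l * D m v $ l)) / G m $ p = v $ p - (\<Sum>l\<in>UNIV. G m $ l * v $ l)"
      using p by (simp add: Dp field_simps)
    then have "E (D m v) = D m v + (v $ p - (\<Sum>l\<in>UNIV. G m $ l * v $ l)) *s ?e"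
      unfolding E_def by (simp only:)
    also have "\<dots> = v" by (simp add: D_def vec_eq_iff algebra_simps)
    finally show ?thesis .
  qed
  have "bounded_linear E"
    unfolding E_def
    by (intro bounded_linear_add bounded_linear_ident bounded_linear_compose [OF bounded_linear_vector_smult]
        bounded_linear_compose [OF bounded_linear_divide] bounded_linear_sub bounded_linear_sum
        bounded_linear_const_mult bounded_linear_vec_nth)
  then have inv: "Blinfun E o\<^sub>L Blinfun (D m) = id_blinfun"
    using W(3) by (intro blinfun_eqI) (simp add: BD bounded_linear_Blinfun_apply ED)
  have contD: "continuous_on W (\<lambda>x. Blinfun (D x))"
  proof (rule continuous_on_blinfun_componentwise)
    fix i :: "complex ^ 'n"
    have "continuous_on W (\<lambda>x. D x i)"
      unfolding D_def
      by (intro continuous_on_add continuous_on_const bounded_linear.continuous_on [OF bounded_linear_vector_smult]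
          continuous_on_diff continuous_on_sum continuous_on_mult continuous_on_subset [OF contG W(2)])
    then show "continuous_on W (\<lambda>x. blinfun_apply (Blinfun (D x)) i)"
      by (simp add: BD cong: continuous_on_cong)
  qed
  obtain W' V g g' where W': "open W'" "W' \<subseteq> W" "m \<in> W'" and V: "open V" "\<Phi> m \<in> V"
    and hom: "homeomorphism W' V \<Phi> g"
    and g: "\<And>y. y \<in> V \<Longrightarrow> (g has_derivative g' y) (at y)"
    and g': "\<And>y. y \<in> V \<Longrightarrow> g' y = inv (blinfun_apply (Blinfun (D (g y))))"
    and bij: "\<And>y. y \<in> V \<Longrightarrow> bij (blinfun_apply (Blinfun (D (g y))))"
    using inverse_function_theorem [OF W(1) _ contD W(3) inv] der\<Phi> BD by (metis (no_types, lifting))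
  have gV: "g y \<in> W'" if "y \<in> V" for y using hom that by (auto simp: homeomorphism_def)
  have bijD: "bij (D (g y))" and g'_inv: "g' y = inv (D (g y))" if "y \<in> V" for y
    using bij [OF that] g' [OF that] BD [of "g y"] gV [OF that] W'(2) by auto
  have Dg': "D (g y) (g' y w) = w" if "y \<in> V" for y w
    using bijD [OF that] g'_inv [OF that] by (simp add: bij_is_surj surj_f_inv_f)
  \<comment> \<open>The inverse function theorem is a real statement; complex linearity of
    \<open>g'\<close> is inherited from its inverse \<open>D (g y)\<close> and is needed for
    holomorphy of \<open>f\<close>.\<close>
  have g'_scale: "g' y (c *s w) = c *s g' y w" if "y \<in> V" for y c w
    using bij_is_inj [OF bijD [OF that]] Dg' [OF that] by (metis D_scale injD)
  define \<kappa> where "\<kappa> = lam \<circ> g"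
  have der\<kappa>: "\<exists>\<Lambda>. has_grad lam \<Lambda> (g y) \<and> (\<kappa> has_derivative (\<lambda>w. \<Sum>l\<in>UNIV. \<Lambda> $ l * g' y w $ l)) (at y)"
    if y: "y \<in> V" for y
  proof -
    obtain \<Lambda> where \<Lambda>: "has_grad lam \<Lambda> (g y)" using grad_lam gV [OF y] W'(2) by blast
    from has_derivative_compose [OF g [OF y] this [unfolded has_grad_def]] \<Lambda>
    show ?thesis unfolding \<kappa>_def comp_def by blast
  qed
  obtain r where r: "r > 0" "ball (\<Phi> m) r \<subseteq> V" using V open_contains_ball by blast
  \<comment> \<open>Along the segment the direction has p-th coordinate 0, so its image under
    \<open>g'\<close> is killed by du and hence by the differential of \<open>lam\<close>. Convexity
    of the ball keeps the segment inside.\<close>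
  have \<kappa>_const: "\<kappa> y = \<kappa> y'" if y: "y \<in> ball (\<Phi> m) r" "y' \<in> ball (\<Phi> m) r" "y $ p = y' $ p" for y y'
  proof -
    let ?\<gamma> = "\<lambda>t :: real. y + t *\<^sub>R (y' - y)"
    have "((\<lambda>t. \<kappa> (?\<gamma> t)) has_vector_derivative 0) (at t within {0..1})" if "t \<in> {0..1}" for t
    proof -
      have "?\<gamma> t = (1 - t) *\<^sub>R y + t *\<^sub>R y'" by (simp add: algebra_simps)
      then have \<gamma>: "?\<gamma> t \<in> V"
        using convexD [OF convex_ball y(1,2), of "1 - t" t] that r(2) by auto
      obtain \<Lambda> where \<Lambda>: "has_grad lam \<Lambda> (g (?\<gamma> t))"
        "(\<kappa> has_derivative (\<lambda>w. \<Sum>l\<in>UNIV. \<Lambda> $ l * g' (?\<gamma> t) w $ l)) (at (?\<gamma> t))"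
        using der\<kappa> [OF \<gamma>] by blast
      have "(?\<gamma> has_derivative (\<lambda>s. s *\<^sub>R (y' - y))) (at t within {0..1})"
        by (auto intro!: derivative_eq_intros)
      from has_derivative_compose [OF this \<Lambda>(2)]
      have "((\<lambda>t. \<kappa> (?\<gamma> t)) has_derivative (\<lambda>s. \<Sum>l\<in>UNIV. \<Lambda> $ l * g' (?\<gamma> t) (s *\<^sub>R (y' - y)) $ l))
          (at t within {0..1})" .
      moreover have "(\<Sum>l\<in>UNIV. \<Lambda> $ l * g' (?\<gamma> t) w $ l) = 0" if "w $ p = 0" for w
        using lam_ker [OF _ \<Lambda>(1)] gV [OF \<gamma>] W'(2) Dp [of "g (?\<gamma> t)"] Dg' [OF \<gamma>] that by (metis subsetD)
      ultimately show ?thesis using y(3) by (simp add: has_vector_derivative_def)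
    qed
    then obtain c where "\<And>t. t \<in> {0..1} \<Longrightarrow> \<kappa> (?\<gamma> t) = c"
      using has_vector_derivative_zero_constant [of "{0..1}"] by (metis convex_real_interval(5))
    from this [of 0] this [of 1] show ?thesis by simp
  qed
  \<comment> \<open>The complex line through \<open>\<Phi> m\<close> in direction e_p is
    parametrized by the value of u; \<open>f\<close> is \<open>\<kappa>\<close> along it.\<close>
  define \<tau> where "\<tau> s = \<Phi> m + (s - u m) *s ?e" for s
  have norm_e: "norm (c *s ?e) = norm c" for c
    by (simp add: norm_eq_sqrt_inner inner_vec_def axis_def if_distrib [of "\<lambda>z. _ * z"] cong: if_cong)
       (simp add: if_distrib inner_commute cmod_def norm_eq_sqrt_inner [symmetric] cong: if_cong)
  have \<tau>_ball: "\<tau> s \<in> ball (\<Phi> m) r" if "s \<in> ball (u m) r" for s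
    using that norm_e [of "s - u m"] by (simp add: \<tau>_def dist_norm norm_minus_commute)
  have \<tau>_fun: "\<tau> = (\<lambda>s. \<Phi> m + (s - u m) *s ?e)" by (simp add: \<tau>_def fun_eq_iff)
  have \<tau>p: "\<tau> s $ p = s" for s by (simp add: \<tau>_def \<Phi>p)
  define f where "f s = \<kappa> (\<tau> s)" for s
  have "f holomorphic_on ball (u m) r"
    unfolding holomorphic_on_open [OF open_ball]
  proof
    fix s assume s: "s \<in> ball (u m) r"
    then have V: "\<tau> s \<in> V" using \<tau>_ball r(2) by blast
    obtain \<Lambda> where \<Lambda>: "(\<kappa> has_derivative (\<lambda>w. \<Sum>l\<in>UNIV. \<Lambda> $ l * g' (\<tau> s) w $ l)) (at (\<tau> s))"
      using der\<kappa> [OF V] by blast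
    have "((\<lambda>s. s - u m) has_derivative (\<lambda>c. c)) (at s)" by (auto intro!: derivative_eq_intros)
    from has_derivative_add [OF has_derivative_const [of "\<Phi> m"]
        bounded_linear.has_derivative [OF bounded_linear_vector_smult this, of ?e]]
    have "(\<tau> has_derivative (\<lambda>c. c *s ?e)) (at s)"
      unfolding \<tau>_fun by (simp only: add_0)
    from has_derivative_compose [OF this \<Lambda>]
    have "(f has_derivative (\<lambda>c. \<Sum>l\<in>UNIV. \<Lambda> $ l * g' (\<tau> s) (c *s ?e) $ l)) (at s)"
      by (simp only: f_def [abs_def])
    moreover have "(\<Sum>l\<in>UNIV. \<Lambda> $ l * g' (\<tau> s) (c *s ?e) $ l) = (\<Sum>l\<in>UNIV. \<Lambda> $ l * g' (\<tau> s) ?e $ l) * c" for c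
      unfolding g'_scale [OF V] by (simp add: sum_distrib_left ac_simps)
    ultimately show "\<exists>f'. (f has_field_derivative f') (at s)"
      unfolding has_field_derivative_def by auto
  qed
  moreover have "\<forall>\<^sub>F x in nhds m. u x \<in> ball (u m) r \<and> \<omega> x = f (u x) *s G x"
  proof -
    have "isCont \<Phi> m" using der\<Phi> [OF W(3)] has_derivative_continuous by blast
    then have "\<forall>\<^sub>F x in nhds m. \<Phi> x \<in> ball (\<Phi> m) r"
      using r(1) unfolding isCont_def tendsto_at_iff_tendsto_nhds by (intro topological_tendstoD) auto
    moreover have "\<forall>\<^sub>F x in nhds m. x \<in> W'" using W' by (intro eventually_nhds_in_open)
    ultimately show ?thesis
    proof eventually_elim
      case (elim x)
      \<comment> \<open>As u is a coordinate of \<open>\<Phi>\<close>, the same radius works for the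
        disc around \<open>u m\<close>.\<close>
      have "norm (u x - u m) \<le> norm (\<Phi> x - \<Phi> m)"
        using Finite_Cartesian_Product.norm_nth_le [of "\<Phi> x - \<Phi> m" p] by (simp add: \<Phi>p)
      then have ux: "u x \<in> ball (u m) r"
        using elim(1) by (simp add: dist_norm norm_minus_commute)
      have "f (u x) = \<kappa> (\<Phi> x)"
        unfolding f_def by (rule \<kappa>_const [OF \<tau>_ball [OF ux] elim(1)]) (simp add: \<tau>p \<Phi>p)
      also have "\<dots> = lam x"
        using hom elim(2) by (simp add: \<kappa>_def homeomorphism_def)
      finally show ?case using ux lam elim(2) W'(2) by auto
    qed
  qed
  ultimately show thesis using that r(1) by blast
qed

section \<open>Linear systems and leading Taylor coefficients\<close>

lemma homogeneous_system_nontrivial: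
  fixes A :: "'e \<Rightarrow> 'j \<Rightarrow> 'a::field"
  assumes "finite E" "finite J" "card E < card J"
  shows "\<exists>c. (\<exists>j\<in>J. c j \<noteq> 0) \<and> (\<forall>e\<in>E. (\<Sum>j\<in>J. c j * A e j) = 0)"
  using assms
proof (induction E arbitrary: J A rule: finite_induct)
  case empty
  then obtain j where "j \<in> J" by fastforce
  then show ?case by (intro exI [of _ "\<lambda>_. 1"]) auto
next
  case (insert e E)
  show ?case
  proof (cases "\<forall>j\<in>J. A e j = 0")
    case True
    then show ?thesis using insert.IH [of J A] insert.prems insert.hyps by auto
  next
    case False
    then obtain i where i: "i \<in> J" "A e i \<noteq> 0" by blast
    \<comment> \<open>Equation \<open>e\<close> is solved for the unknown \<open>i\<close>, and the
      result is substituted into the other equations.\<close>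
    define B where "B e' j = A e' j - A e' i * (A e j / A e i)" for e' j
    have "card E < card (J - {i})" using insert.prems insert.hyps i(1) by simp
    then obtain c where c: "\<exists>j\<in>J - {i}. c j \<noteq> 0" "\<forall>e'\<in>E. (\<Sum>j\<in>J - {i}. c j * B e' j) = 0"
      using insert.IH [of "J - {i}" B] insert.prems(1) by auto
    define s where "s = (\<Sum>j\<in>J - {i}. c j * (A e j / A e i))"
    define d where "d j = (if j = i then - s else c j)" for j
    have split: "(\<Sum>j\<in>J. d j * A e' j) = (\<Sum>j\<in>J - {i}. c j * A e' j) - s * A e' i" for e'
      using insert.prems(1) i(1) by (simp add: sum.remove [of J i] d_def)
    have "(\<Sum>j\<in>J. d j * A e j) = 0"
      unfolding split s_def using i(2) by (simp add: sum_distrib_right)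
    moreover have "(\<Sum>j\<in>J. d j * A e' j) = 0" if "e' \<in> E" for e'
    proof -
      have "(\<Sum>j\<in>J - {i}. c j * B e' j) = (\<Sum>j\<in>J - {i}. c j * A e' j) - s * A e' i"
        unfolding B_def s_def right_diff_distrib sum_subtractf sum_distrib_right
        by (simp add: ac_simps)
      then show ?thesis unfolding split using c(2) that by simp
    qed
    moreover have "\<exists>j\<in>J. d j \<noteq> 0" using c(1) by (auto simp: d_def)
    ultimately show ?thesis by (intro exI [of _ d]) auto
  qed
qed

lemma eventually_along_line:
  assumes "\<forall>\<^sub>F x in nhds (m :: complex ^ 'n). P x"
  shows "\<forall>\<^sub>F t in nhds 0. P (m + t *s v)"
proof -
  have "isCont (\<lambda>t. m + t *s v) 0"
    using bounded_linear.has_derivative [OF bounded_linear_vector_smult has_derivative_ident, of v]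
    by (intro isCont_add continuous_const) (rule has_derivative_continuous)
  then have "((\<lambda>t. m + t *s v) \<longlongrightarrow> m + 0 *s v) (nhds 0)"
    by (simp only: isCont_def tendsto_at_iff_tendsto_nhds [of "\<lambda>t. m + t *s v" 0])
  then have "filterlim (\<lambda>t. m + t *s v) (nhds m) (nhds 0)" by simp
  then show ?thesis using assms by (simp add: filterlim_iff)
qed

lemma has_grad_tendsto_along_line:
  assumes "has_grad f F m"
  shows "((\<lambda>t. f (m + t *s v)) \<longlongrightarrow> f m) (at 0)"
  using DERIV_isCont [OF has_grad_line [of f F m 0 v]] assms by (simp add: isCont_def)

text \<open>Division by z^h, with only continuity of the quotient at 0. The point 0 is treated apart
  because of h = 0, where \<open>0 ^ h\<close> is 1.\<close>

lemma has_fps_expansion_factor_power: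
  assumes f: "f has_fps_expansion F" and F: "\<And>k. k < h \<Longrightarrow> fps_nth F k = 0"
  obtains g :: "complex \<Rightarrow> complex" where "isCont g 0" "g 0 = fps_nth F h" "\<And>z. z \<noteq> 0 \<Longrightarrow> f z = z ^ h * g z"
    "f 0 = 0 ^ h * g 0"
proof -
  define g where "g z = (if z = 0 then fps_nth F h else f z / z ^ h)" for z
  have f0: "f 0 = fps_nth F 0" using has_fps_expansion_imp_0_eq_fps_nth_0 [OF f] by simp
  have "isCont g 0"
  proof (cases "F = 0")
    case True
    then have "\<forall>\<^sub>F z in nhds 0. f z = 0" using f by (simp add: has_fps_expansion_0_iff)
    then have "\<forall>\<^sub>F z in nhds 0. g z = 0" by eventually_elim (simp add: g_def True)
    then show ?thesis using isCont_cong by fastforce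
  next
    case False
    then have "h \<le> subdegree F" using F by (intro subdegree_geI) auto
    from has_fps_expansion_imp_continuous [OF has_fps_expansion_shift [OF f this refl], of UNIV]
    show ?thesis by (simp add: g_def [abs_def])
  qed
  moreover have "f 0 = 0 ^ h * g 0" using f0 F [of 0] by (cases h) (auto simp: g_def)
  moreover have "g 0 = fps_nth F h" "f z = z ^ h * g z" if "z \<noteq> 0" for z
    using that by (simp_all add: g_def)
  ultimately show thesis using that [of g] by (simp add: g_def)
qed

text \<open>Restrict the relation to the line \<open>m + t v\<close> and read off the coefficient of \<open>t\<^sup>h\<close>.\<close>

lemma leading_coefficients_power_relation:
  fixes m :: "complex ^ 'n::finite"
  assumes F: "\<And>a. a \<in> I \<Longrightarrow> (\<lambda>z. f a (WB a m + z)) has_fps_expansion F a"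
    and low: "\<And>a k. a \<in> I \<Longrightarrow> k < h \<Longrightarrow> fps_nth (F a) k = 0"
    and rel: "\<forall>\<^sub>F x in nhds m. (\<Sum>a\<in>I. f a (WB a x) *s WB_grad a x) = 0"
  shows "power_relation I (\<lambda>a. WB_grad a m) (Suc h) (\<lambda>a. fps_nth (F a) h)"
proof (rule power_relation_polarize)
  fix v :: "complex ^ 'n"
  define d where "d a x = (\<Sum>l\<in>UNIV. WB_grad a x $ l * v $ l)" for a x
  \<comment> \<open>The difference quotient of u along the line; it tends to du(v) at m.\<close>
  define q where "q a t = (WB a (m + t *s v) - WB a m) / t" for a t
  have "\<exists>g. isCont g 0 \<and> g 0 = fps_nth (F a) h \<and> (\<forall>z. f a (WB a m + z) = z ^ h * g z)" if "a \<in> I" for a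
    using has_fps_expansion_factor_power [OF F [OF that] low [OF that]] by metis
  then obtain g where g: "\<And>a. a \<in> I \<Longrightarrow> isCont (g a) 0" "\<And>a. a \<in> I \<Longrightarrow> g a 0 = fps_nth (F a) h"
    "\<And>a z. a \<in> I \<Longrightarrow> f a (WB a m + z) = z ^ h * g a z"
    by metis
  \<comment> \<open>The relation along the line, contracted with v, is t^h times \<open>S t\<close>.
    Its limit contains h factors du(v) from u^h and one more from the form du itself, hence the
    exponent \<open>Suc h\<close>.\<close>
  define S where "S t = (\<Sum>a\<in>I. q a t ^ h * g a (WB a (m + t *s v) - WB a m) * d a (m + t *s v))" for t
  have lim: "(S \<longlongrightarrow> (\<Sum>a\<in>I. d a m ^ h * g a 0 * d a m)) (at 0)"
    unfolding S_def
  proof (intro tendsto_sum tendsto_mult tendsto_power)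
    fix a assume a: "a \<in> I"
    have "((\<lambda>t. WB a (m + t *s v)) has_field_derivative d a m) (at 0)"
      using has_grad_line [of "WB a" "WB_grad a m" m 0 v] has_grad_WB [of a m] by (simp add: d_def)
    then show "(q a \<longlongrightarrow> d a m) (at 0)"
      unfolding q_def DERIV_def by simp
    have "((\<lambda>t. WB a (m + t *s v) - WB a m) \<longlongrightarrow> WB a m - WB a m) (at 0)"
      by (intro tendsto_diff tendsto_const has_grad_tendsto_along_line [OF has_grad_WB])
    then have "((\<lambda>t. WB a (m + t *s v) - WB a m) \<longlongrightarrow> 0) (at 0)" by simp
    then show "((\<lambda>t. g a (WB a (m + t *s v) - WB a m)) \<longlongrightarrow> g a 0) (at 0)"
      by (rule isCont_tendsto_compose [OF g(1) [OF a]])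
    show "((\<lambda>t. d a (m + t *s v)) \<longlongrightarrow> d a m) (at 0)"
      unfolding d_def
    proof (intro tendsto_sum tendsto_mult tendsto_const)
      fix l
      show "((\<lambda>t. WB_grad a (m + t *s v) $ l) \<longlongrightarrow> WB_grad a m $ l) (at 0)"
        using WB_grad_symmetric [of a m] has_grad_tendsto_along_line by blast
    qed
  qed
  have "\<forall>\<^sub>F t in at 0. S t = 0"
  proof -
    have "\<forall>\<^sub>F t in at 0. (\<Sum>a\<in>I. f a (WB a (m + t *s v)) *s WB_grad a (m + t *s v)) = 0"
      using eventually_along_line [OF rel, of v] by (simp add: eventually_nhds_conv_at)
    moreover have "\<forall>\<^sub>F t in at (0 :: complex). t \<noteq> 0" by (rule eventually_neq_at_within)
    ultimately show ?thesis
    proof eventually_elim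
      case (elim t)
      let ?x = "m + t *s v"
      have e: "f a (WB a ?x) * d a ?x = t ^ h * (q a t ^ h * g a (WB a ?x - WB a m) * d a ?x)" if "a \<in> I" for a
        using g(3) [OF that, of "WB a ?x - WB a m"] elim(2) by (simp add: q_def power_divide)
      then have "t ^ h * S t = (\<Sum>a\<in>I. f a (WB a ?x) * d a ?x)"
        unfolding S_def sum_distrib_left by (intro sum.cong refl e [symmetric])
      also have "\<dots> = (\<Sum>l\<in>UNIV. \<Sum>a\<in>I. f a (WB a ?x) * (WB_grad a ?x $ l * v $ l))"
        unfolding d_def sum_distrib_left by (rule sum.swap)
      also have "\<dots> = (\<Sum>l\<in>UNIV. (\<Sum>a\<in>I. f a (WB a ?x) *s WB_grad a ?x) $ l * v $ l)"
        by (simp add: sum_component sum_distrib_right mult.assoc)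
      also have "\<dots> = 0" unfolding elim(1) by simp
      finally show "S t = 0" using elim(2) by simp
    qed
  qed
  from tendsto_unique [OF at_neq_bot lim tendsto_eventually [OF this]]
  have "(\<Sum>a\<in>I. d a m ^ h * g a 0 * d a m) = 0" .
  then show "(\<Sum>a\<in>I. fps_nth (F a) h * (\<Sum>l\<in>UNIV. WB_grad a m $ l * v $ l) ^ Suc h) = 0"
    by (simp add: d_def g(2) ac_simps)
qed

lemma abelian_germ_WB_factor:
  fixes m :: "complex ^ 'n::{finite,linorder}"
  assumes n: "CARD('n) \<ge> 2" and germ: "abelian_germ WB_index WB m \<omega>" and a: "a \<in> WB_index"
  shows "\<exists>f F. (\<lambda>z. f (WB a m + z)) has_fps_expansion F \<and> (\<forall>\<^sub>F x in nhds m. \<omega> a x = f (WB a x) *s WB_grad a x)"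
proof -
  obtain U where U: "open U" "m \<in> U" "U \<subseteq> regular_locus WB_index WB" "abelian_relation WB_index WB U \<omega>"
    using germ by (auto simp: abelian_germ_def)
  then have "m \<in> WB_locus" using regular_locus_WB [OF n] by auto
  then obtain p where p: "WB_grad a m $ p \<noteq> 0" using WB_grad_nonzero a by blast
  have "holo_on (\<lambda>x. \<omega> a x $ l) U"
    "x \<in> U \<Longrightarrow> partial (\<lambda>y. \<omega> a y $ k) l x = partial (\<lambda>y. \<omega> a y $ l) k x"
    "x \<in> U \<Longrightarrow> form_ker (WB_grad a x) \<subseteq> form_ker (\<omega> a x)" for x k l
    using U(4) a by (auto simp: abelian_relation_def differential_WB)
  from closed_form_factors_through_first_integral [OF U(1,2) has_grad_WB WB_grad_symmetric p this]
  obtain f r where r: "r > 0" "f holomorphic_on ball (WB a m) r"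
    "\<forall>\<^sub>F x in nhds m. WB a x \<in> ball (WB a m) r \<and> \<omega> a x = f (WB a x) *s WB_grad a x" .
  then have "f analytic_on {WB a m}" unfolding analytic_at by (intro exI [of _ "ball (WB a m) r"]) auto
  note analytic_at_imp_has_fps_expansion [OF this]
  moreover have "\<forall>\<^sub>F x in nhds m. \<omega> a x = f (WB a x) *s WB_grad a x"
    using r(3) by (rule eventually_mono) blast
  ultimately show ?thesis by blast
qed

text \<open>More germs than functionals would leave a nontrivial combination on which all
  functionals vanish. All Taylor coefficients of that combination are then zero, against
  independence.\<close>

lemma abelian_dim_WB_le:
  fixes m :: "complex ^ 'n::{finite,linorder}"
  assumes n: "CARD('n) \<ge> 2" and m: "m \<in> WB_locus"
  shows "abelian_dim WB_index WB m \<le> enat (pi' CARD('n) (cdim CARD('n) 4))"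
  unfolding abelian_dim_def
proof (rule Sup_least, clarify)
  fix k and \<omega> :: "nat \<Rightarrow> 'n wb_index \<Rightarrow> (complex, 'n) vec \<Rightarrow> (complex, 'n) vec"
  assume germ: "\<forall>j<k. abelian_germ WB_index WB m (\<omega> j)" and ind: "independent_germs WB_index m k \<omega>"
  let ?I = "WB_index :: 'n wb_index set"
  show "enat k \<le> enat (pi' CARD('n) (cdim CARD('n) 4))"
  proof (rule ccontr)
    assume "\<not> enat k \<le> enat (pi' CARD('n) (cdim CARD('n) 4))"
    then have k: "pi' CARD('n) (cdim CARD('n) 4) < k" by simp
    define P where "P j a f F \<longleftrightarrow> (\<lambda>z. f (WB a m + z)) has_fps_expansion F \<and>
        (\<forall>\<^sub>F x in nhds m. \<omega> j a x = f (WB a x) *s WB_grad a x)" for j a f F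
    have "\<exists>f F. P j a f F" if "j < k" "a \<in> ?I" for j a
      using abelian_germ_WB_factor [OF n _ that(2)] germ that(1) unfolding P_def by blast
    then obtain f F where P: "\<And>j a. j < k \<Longrightarrow> a \<in> ?I \<Longrightarrow> P j a (f j a) (F j a)"
      by metis
    have F: "\<And>j a. j < k \<Longrightarrow> a \<in> ?I \<Longrightarrow> (\<lambda>z. f j a (WB a m + z)) has_fps_expansion F j a"
      and f: "\<And>j a. j < k \<Longrightarrow> a \<in> ?I \<Longrightarrow> \<forall>\<^sub>F x in nhds m. \<omega> j a x = f j a (WB a x) *s WB_grad a x"
      using P unfolding P_def by blast+
    \<comment> \<open>The pair (h, a) stands for the coefficient of order h - 1 of the function at
      \<open>a\<close>; the shift is there because coefficients of order h - 1 enter a relation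
      among h-th powers.\<close>
    define E where "E = Sigma {1, 2, 3} (\<lambda>h. ?I - WB_low h)"
    have finI: "finite ?I" by (rule finite_WB_index)
    have "card (?I - WB_low h) = cdim CARD('n) 4 - cdim CARD('n) h" if h: "h \<in> {1, 2, 3}" for h
    proof -
      have low: "WB_low h \<subseteq> ?I" by (rule WB_low_subset)
      have "card ?I = cdim CARD('n) 4" using n by (simp add: card_WB_index cdim_low)
      then show ?thesis
        using card_Diff_subset [OF finite_subset [OF low finI] low] card_WB_low [OF h, where 'n='n] by simp
    qed
    moreover have "card E = (\<Sum>h\<in>{1, 2, 3}. card (?I - WB_low h))"
      unfolding E_def using finI by (intro card_SigmaI) auto
    ultimately have "card E = (\<Sum>h\<in>{1, 2, 3}. cdim CARD('n) 4 - cdim CARD('n) h)"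
      by simp
    also have "\<dots> = pi' CARD('n) (cdim CARD('n) 4)"
    proof -
      \<comment> \<open>The summand at 4 is c(n,4) - c(n,4) = 0.\<close>
      have "{1..4} = insert 4 {1, 2, 3 :: nat}" by auto
      then show ?thesis unfolding pi'_def k0_cdim [OF n] by simp
    qed
    finally have cardE: "card E < card {..<k}" using k by simp
    have finE: "finite E" unfolding E_def using finI by auto
    obtain c where c: "\<exists>j\<in>{..<k}. c j \<noteq> 0"
      "\<forall>e\<in>E. (\<Sum>j<k. c j * fps_nth (F j (snd e)) (fst e - 1)) = 0"
      using homogeneous_system_nontrivial [OF finE _ cardE, of "\<lambda>e j. fps_nth (F j (snd e)) (fst e - 1)"] by auto
    define fc where "fc a s = (\<Sum>j<k. c j * f j a s)" for a s
    define Fc where "Fc a = (\<Sum>j<k. fps_const (c j) * F j a)" for a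
    have Fc: "(\<lambda>z. fc a (WB a m + z)) has_fps_expansion Fc a" if "a \<in> ?I" for a
      unfolding fc_def Fc_def using F that by (intro has_fps_expansion_sum has_fps_expansion_cmult_left) auto
    have Fc_nth: "fps_nth (Fc a) h = (\<Sum>j<k. c j * fps_nth (F j a) h)" for a h
      by (simp add: Fc_def fps_sum_nth)
    have f_all: "\<forall>\<^sub>F x in nhds m. \<forall>j\<in>{..<k}. \<forall>a\<in>?I. \<omega> j a x = f j a (WB a x) *s WB_grad a x"
      using f finite_WB_index by (intro eventually_ball_finite ballI) auto
    have \<omega>_fc: "\<forall>\<^sub>F x in nhds m. \<forall>a\<in>?I. (\<Sum>j<k. c j *s \<omega> j a x) = fc a (WB a x) *s WB_grad a x"
      using f_all
    proof eventually_elim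
      case (elim x)
      have "(\<Sum>j<k. c j *s \<omega> j a x) = (\<Sum>j<k. c j *s (f j a (WB a x) *s WB_grad a x))" if "a \<in> ?I" for a
        using elim that by (intro sum.cong) auto
      then show ?case by (simp add: fc_def vec_eq_iff sum_component sum_distrib_right mult.assoc)
    qed
    have "\<forall>\<^sub>F x in nhds m. \<forall>j\<in>{..<k}. (\<Sum>a\<in>?I. \<omega> j a x) = 0"
    proof (intro eventually_ball_finite ballI)
      fix j assume "j \<in> {..<k}"
      then obtain U where "open U" "m \<in> U" "abelian_relation ?I WB U (\<omega> j)"
        using germ by (auto simp: abelian_germ_def)
      then show "\<forall>\<^sub>F x in nhds m. (\<Sum>a\<in>?I. \<omega> j a x) = 0"
        unfolding eventually_nhds abelian_relation_def by blast
    qed simp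
    with \<omega>_fc have rel: "\<forall>\<^sub>F x in nhds m. (\<Sum>a\<in>?I. fc a (WB a x) *s WB_grad a x) = 0"
    proof eventually_elim
      case (elim x)
      have "(\<Sum>a\<in>?I. fc a (WB a x) *s WB_grad a x) = (\<Sum>a\<in>?I. \<Sum>j<k. c j *s \<omega> j a x)"
        using elim(1) by (intro sum.cong) auto
      also have "\<dots> = (\<Sum>j<k. \<Sum>a\<in>?I. c j *s \<omega> j a x)" by (rule sum.swap)
      also have "\<dots> = (\<Sum>j<k. c j *s (\<Sum>a\<in>?I. \<omega> j a x))"
        by (simp add: vec_eq_iff sum_component sum_distrib_left)
      also have "\<dots> = 0" using elim(2) by (simp add: vec_eq_iff sum_component)
      finally show ?case .
    qed
    \<comment> \<open>By induction all lower orders vanish, so order h is the leading one. Up to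
      order 2 the functionals in \<open>E\<close> reduce its relation to
      \<open>WB_low (Suc h)\<close>; from order 3 on, independence of high powers suffices.\<close>
    have Fc0: "\<forall>a\<in>?I. fps_nth (Fc a) h = 0" for h
    proof (induction h rule: less_induct)
      case (less h)
      have R: "power_relation ?I (\<lambda>a. WB_grad a m) (Suc h) (\<lambda>a. fps_nth (Fc a) h)"
        using less by (intro leading_coefficients_power_relation [OF Fc _ rel]) auto
      show ?case
      proof (cases "Suc h \<ge> 4")
        case True
        then show ?thesis using power_relation_high_imp_0 [OF m R] by blast
      next
        case False
        then have h: "Suc h \<in> {1, 2, 3}" by auto
        have "fps_nth (Fc a) h = 0" if "a \<in> ?I - WB_low (Suc h)" for a
        proof -
          have "(Suc h, a) \<in> E" unfolding E_def using h that by blast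
          with c(2) show ?thesis unfolding Fc_nth by force
        qed
        then show ?thesis using power_relation_low_imp_0 [OF R h] by blast
      qed
    qed
    have "\<forall>\<^sub>F x in nhds m. \<forall>a\<in>?I. fc a (WB a x) = 0"
    proof (intro eventually_ball_finite finite_WB_index ballI)
      fix a :: "'n wb_index" assume a: "a \<in> ?I"
      then have "Fc a = 0" using Fc0 by (simp add: fps_eq_iff)
      with Fc [OF a] have "\<forall>\<^sub>F z in nhds 0. fc a (WB a m + z) = 0" by (simp add: has_fps_expansion_0_iff)
      moreover have "filterlim (\<lambda>x. WB a x - WB a m) (nhds 0) (nhds m)"
      proof -
        have "(WB a \<longlongrightarrow> WB a m) (nhds m)"
          using has_grad_imp_isCont [OF has_grad_WB [of a m]] unfolding isCont_def tendsto_at_iff_tendsto_nhds .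
        from tendsto_diff [OF this tendsto_const [of "WB a m"]] show ?thesis by simp
      qed
      ultimately have "\<forall>\<^sub>F x in nhds m. fc a (WB a m + (WB a x - WB a m)) = 0"
        unfolding filterlim_iff by blast
      then show "\<forall>\<^sub>F x in nhds m. fc a (WB a x) = 0" by simp
    qed
    with \<omega>_fc have "\<forall>\<^sub>F x in nhds m. \<forall>a\<in>?I. (\<Sum>j<k. c j *s \<omega> j a x) = 0"
      by eventually_elim auto
    then have "\<forall>j<k. c j = 0" using ind unfolding independent_germs_def by blast
    with c(1) show False by auto
  qed
qed

section \<open>Lower bound for the rank\<close>

text \<open>Functions g for which relations between the g(u) are written down; the abelian relations
  are their differentials g'(u) du. The logarithm is the principal branch.\<close>

datatype wb_prim = Power nat | LogPower nat

fun prim :: "wb_prim \<Rightarrow> complex \<Rightarrow> complex" where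
  "prim (Power k) s = s ^ k"
| "prim (LogPower k) s = Ln s ^ k"

fun dprim :: "wb_prim \<Rightarrow> complex \<Rightarrow> complex" where
  "dprim (Power k) s = of_nat k * s ^ (k - 1)"
| "dprim (LogPower k) s = of_nat k * Ln s ^ (k - 1) / s"

lemma prim_has_field_derivative:
  assumes "s \<notin> \<real>\<^sub>\<le>\<^sub>0"
  shows "(prim e has_field_derivative dprim e s) (at s)"
proof (cases e)
  case (Power k)
  have "prim e = (\<lambda>s. s ^ k)" using Power by auto
  then show ?thesis using DERIV_power [OF DERIV_ident, of k] Power by simp
next
  case (LogPower k)
  have "prim e = (\<lambda>s. Ln s ^ k)" using LogPower by auto
  then show ?thesis
    using DERIV_power [OF has_field_derivative_Ln [OF assms], of k] LogPower by (simp add: field_simps)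
qed

text \<open>Only existence is needed, and the derivative of a holomorphic function is
  holomorphic.\<close>

lemma dprim_has_field_derivative:
  assumes "s \<notin> \<real>\<^sub>\<le>\<^sub>0"
  shows "\<exists>D. (dprim e has_field_derivative D) (at s)"
proof -
  have o: "open (- \<real>\<^sub>\<le>\<^sub>0 :: complex set)" by (simp add: open_Compl)
  have "prim e holomorphic_on - \<real>\<^sub>\<le>\<^sub>0"
    unfolding holomorphic_on_open [OF o] using prim_has_field_derivative by blast
  then have "deriv (prim e) holomorphic_on - \<real>\<^sub>\<le>\<^sub>0" using o by (rule holomorphic_deriv)
  moreover have "deriv (prim e) s = dprim e s" if "s \<in> - \<real>\<^sub>\<le>\<^sub>0" for s
    using DERIV_imp_deriv [OF prim_has_field_derivative] that by simp
  ultimately have "dprim e holomorphic_on - \<real>\<^sub>\<le>\<^sub>0" by (rule holomorphic_transform)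
  then show ?thesis using assms unfolding holomorphic_on_open [OF o] by blast
qed

text \<open>In the variable \<open>w = Ln s\<close> a relation between the \<open>dprim\<close> reads \<open>P (e\<^sup>w) + Q w = 0\<close>
  with polynomials \<open>P\<close> and \<open>Q\<close>; by periodicity of \<open>e\<^sup>w\<close> both are constant.\<close>

lemma dprim_independent:
  assumes s0: "s0 \<notin> \<real>\<^sub>\<le>\<^sub>0"
    and rel: "\<forall>\<^sub>F s in nhds s0. (\<Sum>k = 1..N. \<alpha> k * dprim (Power k) s) + (\<Sum>k = 1..N. \<beta> k * dprim (LogPower k) s) = 0"
    and k: "k \<in> {1..N}"
  shows "\<alpha> k = 0 \<and> \<beta> k = 0"
proof -
  \<comment> \<open>After multiplication by s = e^w, a power contributes k * (e^w)^k and a power of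
    the logarithm k * w^(k-1). So \<open>P\<close> has no constant term, whereas \<open>Q\<close>
    may have one.\<close>
  define P where "P = (\<Sum>k = 1..N. monom (\<alpha> k * of_nat k) k)"
  define Q where "Q = (\<Sum>k = 1..N. monom (\<beta> k * of_nat k) (k - 1))"
  have s0': "s0 \<noteq> 0" using s0 by auto
  have "isCont exp (Ln s0)" by simp
  then have "filterlim exp (nhds s0) (nhds (Ln s0))"
    using s0' unfolding isCont_def tendsto_at_iff_tendsto_nhds by simp
  then have 1: "\<forall>\<^sub>F w in nhds (Ln s0). (\<Sum>k = 1..N. \<alpha> k * dprim (Power k) (exp w)) +
      (\<Sum>k = 1..N. \<beta> k * dprim (LogPower k) (exp w)) = 0"
    using rel unfolding filterlim_iff by blast
  \<comment> \<open>In this strip \<open>Ln (exp w) = w\<close>.\<close>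
  have "open {w. - pi < Im w \<and> Im w < pi}"
    by (intro open_Collect_conj open_Collect_less continuous_intros)
  then have "\<forall>\<^sub>F w in nhds (Ln s0). w \<in> {w. - pi < Im w \<and> Im w < pi}"
    using mpi_less_Im_Ln [OF s0'] Im_Ln_less_pi [OF s0] by (intro eventually_nhds_in_open) auto
  with 1 have "\<forall>\<^sub>F w in nhds (Ln s0). poly P (exp w) + poly Q w = 0"
  proof eventually_elim
    case (elim w)
    have Ln: "Ln (exp w) = w" using elim(2) by (intro Ln_exp) auto
    have "exp w * (\<alpha> k * dprim (Power k) (exp w)) = \<alpha> k * of_nat k * exp w ^ k" if "k \<in> {1..N}" for k
      using that by (cases k) auto
    then have 1: "exp w * (\<Sum>k = 1..N. \<alpha> k * dprim (Power k) (exp w)) = (\<Sum>k = 1..N. \<alpha> k * of_nat k * exp w ^ k)"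
      unfolding sum_distrib_left by (rule sum.cong [OF refl])
    have "exp w * (\<beta> k * dprim (LogPower k) (exp w)) = \<beta> k * of_nat k * w ^ (k - 1)" for k
      by (simp add: Ln)
    then have 2: "exp w * (\<Sum>k = 1..N. \<beta> k * dprim (LogPower k) (exp w)) =
        (\<Sum>k = 1..N. \<beta> k * of_nat k * w ^ (k - 1))"
      unfolding sum_distrib_left by (rule sum.cong [OF refl])
    have "exp w * ((\<Sum>k = 1..N. \<alpha> k * dprim (Power k) (exp w)) +
          (\<Sum>k = 1..N. \<beta> k * dprim (LogPower k) (exp w)))
       = (\<Sum>k = 1..N. \<alpha> k * of_nat k * exp w ^ k) + (\<Sum>k = 1..N. \<beta> k * of_nat k * w ^ (k - 1))"
      unfolding distrib_left 1 2 ..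
    then show ?case unfolding elim(1) by (simp add: P_def Q_def poly_sum poly_monom)
  qed
  then obtain S where S: "open S" "Ln s0 \<in> S" "\<And>w. w \<in> S \<Longrightarrow> poly P (exp w) + poly Q w = 0"
    unfolding eventually_nhds by blast
  have PQ: "poly P (exp w) + poly Q w = 0" for w
  proof (rule analytic_continuation_open [of S UNIV "\<lambda>w. poly P (exp w) + poly Q w" "\<lambda>_. 0"])
    show "(\<lambda>w. poly P (exp w) + poly Q w) holomorphic_on UNIV"
      by (intro holomorphic_intros) 
  qed (use S in auto)
  \<comment> \<open>For fixed w the polynomial \<open>Q\<close> takes the value - P(e^w) at all
    points w + 2 pi i n, infinitely many.\<close>
  have Q: "Q = [:- poly P (exp w):]" for w
  proof -
    have "range (\<lambda>n :: nat. w + \<i> * (of_int (int n) * (of_real pi * 2))) \<subseteq> {z. poly (Q - [:- poly P (exp w):]) z = 0}"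
      using minus_unique [OF PQ [of "w + \<i> * (of_int (int n) * (of_real pi * 2))" for n, unfolded exp_plus_2pin], symmetric]
      by auto
    moreover have "inj (\<lambda>n :: nat. w + \<i> * (of_int (int n) * (of_real pi * 2)))"
      by (auto intro!: injI)
    ultimately have "infinite {z. poly (Q - [:- poly P (exp w):]) z = 0}"
      using range_inj_infinite infinite_super by blast
    then show ?thesis using poly_roots_finite [of "Q - [:- poly P (exp w):]"] by fastforce
  qed
  define c where "c = poly P (exp 0)"
  have "poly P z = c" if "z \<noteq> 0" for z
    using Q [of "Ln z"] Q [of 0] that by (simp add: c_def)
  then have "- {0} \<subseteq> {z. poly (P - [:c:]) z = 0}" by auto
  moreover have "infinite (- {0 :: complex})" by (simp add: infinite_UNIV_char_0)
  ultimately have "infinite {z. poly (P - [:c:]) z = 0}" using infinite_super by blast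
  then have P: "P = [:c:]" using poly_roots_finite [of "P - [:c:]"] by fastforce
  have coeffP: "coeff P j = (if j \<in> {1..N} then \<alpha> j * of_nat j else 0)" for j
    by (simp add: P_def coeff_sum)
  \<comment> \<open>The constant coefficient of \<open>P\<close> is 0 because its sum starts at k =
    1.\<close>
  have "c = 0" using coeffP [of 0] P by simp
  then have P0: "P = 0" using P by simp
  have Q0: "Q = 0" using Q [of 0] unfolding P0 by simp
  have "coeff Q (k - 1) = (\<Sum>j = 1..N. if j = k then \<beta> j * of_nat j else 0)"
    unfolding Q_def coeff_sum using k by (intro sum.cong) auto
  also have "\<dots> = \<beta> k * of_nat k" using k by simp
  finally show ?thesis using coeffP [of k] k P0 Q0 by auto
qed

text \<open>For \<open>e \<in> wb_leads a\<close>, \<open>prim e (WB a x)\<close> plus the combination \<open>wb_rest a e\<close> vanishes.  The relations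
  are in reduced echelon form: no term of a \<open>wb_rest\<close> is a lead, so each lead occurs in one relation.\<close>

fun wb_leads :: "'n wb_index \<Rightarrow> wb_prim set" where
  "wb_leads (Coord i) = {}"
| "wb_leads (Add2 i j) = {Power 1, Power 2, Power 4}"
| "wb_leads (Diff2 i j) = {Power 1, Power 2}"
| "wb_leads (Mult2 i j) = {LogPower 1}"
| "wb_leads (Add3 i j k) = {Power 1, Power 2, Power 3}"
| "wb_leads (Squares3 i j k) = {Power 1, Power 2, Power 3}"
| "wb_leads (Mult3 i j k) = {LogPower 1, LogPower 2}"
| "wb_leads (Mult4 i j k m) = {LogPower 1, LogPower 2, LogPower 3}"

text \<open>Most entries for cubes and logarithms are polarization: a form of degree q in a sum of
  more than q variables is the alternating sum of its values on partial sums. The fractions in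
  \<open>Squares3\<close> come from (x+y)^6 + (x-y)^6, whose mixed part is 30(x^4 y^2 + x^2 y^4):
  the factor 1/10 produces the 3 of the trinomial expansion, 3/5 corrects the sixth powers, and 6
  x^2 y^2 z^2 is left over. This is also why exponents go up to 6.\<close>

fun wb_rest :: "'n wb_index \<Rightarrow> wb_prim \<Rightarrow> ('n wb_index \<times> wb_prim \<times> complex) list" where
  "wb_rest (Coord i) e = []"
| "wb_rest (Add2 i j) e =
    (if e = Power 1 then [(Coord i, Power 1, -1), (Coord j, Power 1, -1)]
     else if e = Power 2 then [(Coord i, Power 2, -1), (Coord j, Power 2, -1), (Mult2 i j, Power 1, -2)]
     else [(Diff2 i j, Power 4, 1), (Coord i, Power 4, -2), (Coord j, Power 4, -2), (Mult2 i j, Power 2, -12)])"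
| "wb_rest (Diff2 i j) e =
    (if e = Power 1 then [(Coord j, Power 1, -1), (Coord i, Power 1, 1)]
     else [(Coord i, Power 2, -1), (Coord j, Power 2, -1), (Mult2 i j, Power 1, 2)])"
| "wb_rest (Mult2 i j) e = [(Coord i, LogPower 1, -1), (Coord j, LogPower 1, -1)]"
| "wb_rest (Add3 i j k) e =
    (if e = Power 1 then [(Coord i, Power 1, -1), (Coord j, Power 1, -1), (Coord k, Power 1, -1)]
     else if e = Power 2 then [(Coord i, Power 2, -1), (Coord j, Power 2, -1), (Coord k, Power 2, -1),
       (Mult2 i j, Power 1, -2), (Mult2 i k, Power 1, -2), (Mult2 j k, Power 1, -2)]
     else [(Add2 i j, Power 3, -1), (Add2 i k, Power 3, -1), (Add2 j k, Power 3, -1),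
       (Coord i, Power 3, 1), (Coord j, Power 3, 1), (Coord k, Power 3, 1), (Mult3 i j k, Power 1, -6)])"
| "wb_rest (Squares3 i j k) e =
    (if e = Power 1 then [(Coord i, Power 2, -1), (Coord j, Power 2, -1), (Coord k, Power 2, -1)]
     else if e = Power 2 then [(Coord i, Power 4, -1), (Coord j, Power 4, -1), (Coord k, Power 4, -1),
       (Mult2 i j, Power 2, -2), (Mult2 i k, Power 2, -2), (Mult2 j k, Power 2, -2)]
     else [(Coord i, Power 6, -3/5), (Coord j, Power 6, -3/5), (Coord k, Power 6, -3/5),
       (Add2 i j, Power 6, -1/10), (Add2 i k, Power 6, -1/10), (Add2 j k, Power 6, -1/10),
       (Diff2 i j, Power 6, -1/10), (Diff2 i k, Power 6, -1/10), (Diff2 j k, Power 6, -1/10),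
       (Mult3 i j k, Power 2, -6)])"
| "wb_rest (Mult3 i j k) e =
    (if e = LogPower 1 then [(Coord i, LogPower 1, -1), (Coord j, LogPower 1, -1), (Coord k, LogPower 1, -1)]
     else [(Mult2 i j, LogPower 2, -1), (Mult2 i k, LogPower 2, -1), (Mult2 j k, LogPower 2, -1),
       (Coord i, LogPower 2, 1), (Coord j, LogPower 2, 1), (Coord k, LogPower 2, 1)])"
| "wb_rest (Mult4 i j k m) e =
    (if e = LogPower 1 then [(Coord i, LogPower 1, -1), (Coord j, LogPower 1, -1), (Coord k, LogPower 1, -1), (Coord m, LogPower 1, -1)]
     else if e = LogPower 2 then
      [(Mult2 i j, LogPower 2, -1), (Mult2 i k, LogPower 2, -1), (Mult2 i m, LogPower 2, -1), (Mult2 j k, LogPower 2, -1),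
       (Mult2 j m, LogPower 2, -1), (Mult2 k m, LogPower 2, -1),
       (Coord i, LogPower 2, 2), (Coord j, LogPower 2, 2), (Coord k, LogPower 2, 2), (Coord m, LogPower 2, 2)]
     else
      [(Mult3 i j k, LogPower 3, -1), (Mult3 i j m, LogPower 3, -1), (Mult3 i k m, LogPower 3, -1), (Mult3 j k m, LogPower 3, -1),
       (Mult2 i j, LogPower 3, 1), (Mult2 i k, LogPower 3, 1), (Mult2 i m, LogPower 3, 1), (Mult2 j k, LogPower 3, 1),
       (Mult2 j m, LogPower 3, 1), (Mult2 k m, LogPower 3, 1),
       (Coord i, LogPower 3, -1), (Coord j, LogPower 3, -1), (Coord k, LogPower 3, -1), (Coord m, LogPower 3, -1)])"

lemma wb_rest_terms:
  fixes a :: "'n::{finite,linorder} wb_index"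
  assumes "a \<in> WB_index" "e \<in> wb_leads a" "(b, e', c) \<in> set (wb_rest a e)"
  shows "b \<in> WB_index \<and> e' \<notin> wb_leads b \<and> e' \<in> Power ` {1..6} \<union> LogPower ` {1..6}"
  using assms
  by (cases a) (auto simp: WB_index_def split: if_splits)

lemma wb_leads_range: "e \<in> wb_leads a \<Longrightarrow> e \<in> Power ` {1..6} \<union> LogPower ` {1..6}"
  by (cases a) auto

lemma card_WB_leads:
  assumes "CARD('n) \<ge> 2"
  shows "card (Sigma (WB_index :: 'n::{finite,linorder} wb_index set) wb_leads) = pi' CARD('n) (cdim CARD('n) 4)"
proof -
  have "card (Sigma (WB_index :: 'n wb_index set) wb_leads) = (\<Sum>a\<in>(WB_index :: 'n wb_index set). card (wb_leads a))"
  proof (rule card_SigmaI [OF finite_WB_index], rule ballI)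
    show "finite (wb_leads a)" for a :: "'n wb_index" by (cases a) auto
  qed
  also have "\<dots> = 6 * (CARD('n) choose 2) + 8 * (CARD('n) choose 3) + 3 * (CARD('n) choose 4)"
  proof -
    have c: "sum f A = r * card A" if "\<And>a. a \<in> A \<Longrightarrow> f a = r" for f :: "'n wb_index \<Rightarrow> nat" and r A
      using that by simp
    have "sum (\<lambda>a. card (wb_leads a)) (range (Coord :: 'n \<Rightarrow> _)) = 0 * card (range (Coord :: 'n \<Rightarrow> _))"
      "sum (\<lambda>a. card (wb_leads a)) {Add2 i j | i j :: 'n. i < j} = 3 * card {Add2 i j | i j :: 'n. i < j}"
      "sum (\<lambda>a. card (wb_leads a)) {Diff2 i j | i j :: 'n. i < j} = 2 * card {Diff2 i j | i j :: 'n. i < j}"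
      "sum (\<lambda>a. card (wb_leads a)) {Mult2 i j | i j :: 'n. i < j} = 1 * card {Mult2 i j | i j :: 'n. i < j}"
      "sum (\<lambda>a. card (wb_leads a)) {Add3 i j k | i j k :: 'n. i < j \<and> j < k} =
        3 * card {Add3 i j k | i j k :: 'n. i < j \<and> j < k}"
      "sum (\<lambda>a. card (wb_leads a)) {Squares3 i j k | i j k :: 'n. i < j \<and> j < k} =
        3 * card {Squares3 i j k | i j k :: 'n. i < j \<and> j < k}"
      "sum (\<lambda>a. card (wb_leads a)) {Mult3 i j k | i j k :: 'n. i < j \<and> j < k} =
        2 * card {Mult3 i j k | i j k :: 'n. i < j \<and> j < k}"
      "sum (\<lambda>a. card (wb_leads a)) {Mult4 i j k m | i j k m :: 'n. i < j \<and> j < k \<and> k < m} =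
        3 * card {Mult4 i j k m | i j k m :: 'n. i < j \<and> j < k \<and> k < m}"
      by (rule c; auto)+
    then show ?thesis unfolding sum_WB_index card_wb_families by simp
  qed
  finally show ?thesis using pi'_cdim4 [OF assms] by simp
qed

lemma Ln_mult:
  assumes "x \<noteq> 0" "y \<noteq> 0" "\<bar>Im (Ln x) + Im (Ln y)\<bar> < pi"
  shows "Ln (x * y) = Ln x + Ln y"
  using assms by (intro Ln_times_simple) auto

text \<open>With arguments below pi / 4, the sum of up to four of them stays below pi, so
  \<open>Ln\<close> is additive on all products occurring in the web. The rest are polynomial
  identities in the coordinates or their logarithms.\<close>

lemma WB_relation:
  fixes x :: "complex ^ 'n::{finite,linorder}"
  assumes x: "\<And>i. x $ i \<noteq> 0" "\<And>i. \<bar>Im (Ln (x $ i))\<bar> < pi / 4"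
    and a: "a \<in> WB_index" and e: "e \<in> wb_leads a"
  shows "(\<Sum>(b, e', c)\<leftarrow>(a, e, 1) # wb_rest a e. c * prim e' (WB b x)) = 0"
proof -
  have L2: "Ln (x $ i * x $ j) = Ln (x $ i) + Ln (x $ j)" for i j
    using x(2) [of i] x(2) [of j] by (intro Ln_mult) (auto simp: x(1))
  have L3: "Ln (x $ i * x $ j * x $ k) = Ln (x $ i) + Ln (x $ j) + Ln (x $ k)" for i j k
    using x(2) [of i] x(2) [of j] x(2) [of k] by (subst Ln_mult) (auto simp: x(1) L2)
  have L4: "Ln (x $ i * x $ j * x $ k * x $ m) = Ln (x $ i) + Ln (x $ j) + Ln (x $ k) + Ln (x $ m)" for i j k m
    using x(2) [of i] x(2) [of j] x(2) [of k] x(2) [of m] by (subst Ln_mult) (auto simp: x(1) L3)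
  show ?thesis
  proof (cases a)
    case (Coord i) then show ?thesis using e by simp
  next
    case (Add2 i j)
    then consider "e = Power 1" | "e = Power 2" | "e = Power 4" using e by auto
    then show ?thesis
    proof cases
      case 1
      show ?thesis by (simp add: Add2 1)
    next
      case 2
      show ?thesis by (simp add: Add2 2) algebra
    next
      case 3
      show ?thesis by (simp add: Add2 3) algebra
    qed
  next
    case (Diff2 i j)
    then consider "e = Power 1" | "e = Power 2" using e by auto
    then show ?thesis
    proof cases
      case 1
      show ?thesis by (simp add: Diff2 1)
    next
      case 2
      show ?thesis by (simp add: Diff2 2) algebra
    qed
  next
    case (Mult2 i j)
    then show ?thesis using e by (simp add: L2)
  next
    case (Add3 i j k)
    then consider "e = Power 1" | "e = Power 2" | "e = Power 3" using e by auto
    then show ?thesis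
    proof cases
      case 1
      show ?thesis by (simp add: Add3 1)
    next
      case 2
      show ?thesis by (simp add: Add3 2) algebra
    next
      case 3
      show ?thesis by (simp add: Add3 3) algebra
    qed
  next
    case (Squares3 i j k)
    then consider "e = Power 1" | "e = Power 2" | "e = Power 3" using e by auto
    then show ?thesis
    proof cases
      case 1
      show ?thesis by (simp add: Squares3 field_simps 1)
    next
      case 2
      show ?thesis by (simp add: Squares3 field_simps 2) algebra
    next
      case 3
      show ?thesis by (simp add: Squares3 field_simps 3) algebra
    qed
  next
    case (Mult3 i j k)
    then consider "e = LogPower 1" | "e = LogPower 2" using e by auto
    then show ?thesis
    proof cases
      case 1
      show ?thesis by (simp add: Mult3 L2 L3 1)
    next
      case 2
      show ?thesis by (simp add: Mult3 L2 L3 2) algebra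
    qed
  next
    case (Mult4 i j k m)
    then consider "e = LogPower 1" | "e = LogPower 2" | "e = LogPower 3" using e by auto
    then show ?thesis
    proof cases
      case 1
      show ?thesis by (simp add: Mult4 L2 L3 L4 1)
    next
      case 2
      show ?thesis by (simp add: Mult4 L2 L3 L4 2) algebra
    next
      case 3
      show ?thesis by (simp add: Mult4 L2 L3 L4 3) algebra
    qed
  qed
qed

section \<open>From relations between functions to abelian relations\<close>

text \<open>The function f in the component f(u) du that arises when the relation with terms
  \<open>ts\<close> is differentiated.\<close>

definition rel_deriv :: "('n wb_index \<times> wb_prim \<times> complex) list \<Rightarrow> 'n wb_index \<Rightarrow> complex \<Rightarrow> complex" where
  "rel_deriv ts a s = (\<Sum>(b, e, c)\<leftarrow>ts. if b = a then c * dprim e s else 0)"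

definition rel_coeff :: "('n wb_index \<times> wb_prim \<times> complex) list \<Rightarrow> 'n wb_index \<Rightarrow> wb_prim \<Rightarrow> complex" where
  "rel_coeff ts a e = (\<Sum>(b, e', c)\<leftarrow>ts. if b = a \<and> e' = e then c else 0)"

lemma rel_deriv_has_field_derivative:
  assumes "s \<notin> \<real>\<^sub>\<le>\<^sub>0"
  shows "\<exists>D. (rel_deriv ts a has_field_derivative D) (at s)"
proof (induction ts)
  case Nil
  have e: "rel_deriv [] a = (\<lambda>_. 0)" by (simp add: rel_deriv_def fun_eq_iff)
  show ?case unfolding e by (rule exI, rule DERIV_const)
next
  case (Cons t ts)
  obtain b e c where t: "t = (b, e, c)" by (cases t)
  obtain D D' where D: "(rel_deriv ts a has_field_derivative D) (at s)" "(dprim e has_field_derivative D') (at s)"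
    using Cons dprim_has_field_derivative [OF assms, of e] by blast
  have eq: "rel_deriv (t # ts) a = (\<lambda>s. (if b = a then c else 0) * dprim e s + rel_deriv ts a s)"
    by (auto simp: rel_deriv_def t)
  show ?case unfolding eq by (rule exI, rule DERIV_add [OF DERIV_cmult [OF D(2)] D(1)])
qed

lemma rel_deriv_conv_coeff:
  assumes "finite E" "\<And>b e c. (b, e, c) \<in> set ts \<Longrightarrow> e \<in> E"
  shows "rel_deriv ts a s = (\<Sum>e\<in>E. rel_coeff ts a e * dprim e s)"
  using assms(2)
proof (induction ts)
  case (Cons t ts)
  obtain b e c where t: "t = (b, e, c)" by (cases t)
  have "e \<in> E" using Cons.prems t by auto
  have "(\<Sum>e'\<in>E. (if b = a \<and> e = e' then c else 0) * dprim e' s) = (\<Sum>e'\<in>E. if e = e' then (if b = a then c * dprim e s else 0) else 0)"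
    by (rule sum.cong) auto
  also have "\<dots> = (if b = a then c * dprim e s else 0)" using \<open>e \<in> E\<close> assms(1) by simp
  finally have "(\<Sum>e'\<in>E. (if b = a \<and> e = e' then c else 0) * dprim e' s) = (if b = a then c * dprim e s else 0)" .
  moreover have "rel_deriv ts a s = (\<Sum>e\<in>E. rel_coeff ts a e * dprim e s)" using Cons by auto
  ultimately show ?case by (simp add: t rel_deriv_def rel_coeff_def distrib_right sum.distrib)
qed (simp add: rel_deriv_def rel_coeff_def)

lemma sum_rel_deriv:
  assumes "finite I" "\<And>b e c. (b, e, c) \<in> set ts \<Longrightarrow> b \<in> I"
  shows "(\<Sum>a\<in>I. rel_deriv ts a (f a) * g a) = (\<Sum>(b, e, c)\<leftarrow>ts. c * dprim e (f b) * g b)"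
  using assms(2)
proof (induction ts)
  case (Cons t ts)
  obtain b e c where t: "t = (b, e, c)" by (cases t)
  have "b \<in> I" using Cons.prems t by auto
  have "(\<Sum>a\<in>I. (if b = a then c * dprim e (f a) else 0) * g a) = (\<Sum>a\<in>I. if b = a then c * dprim e (f b) * g b else 0)"
    by (rule sum.cong) auto
  also have "\<dots> = c * dprim e (f b) * g b" using \<open>b \<in> I\<close> assms(1) by simp
  finally have "(\<Sum>a\<in>I. (if b = a then c * dprim e (f a) else 0) * g a) = c * dprim e (f b) * g b" .
  moreover have "(\<Sum>a\<in>I. rel_deriv ts a (f a) * g a) = (\<Sum>(b, e, c)\<leftarrow>ts. c * dprim e (f b) * g b)"
    using Cons by auto
  ultimately show ?case by (simp add: t rel_deriv_def distrib_right sum.distrib)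
qed (simp add: rel_deriv_def)

lemma has_grad_rel:
  assumes "\<And>b e c. (b, e, c) \<in> set ts \<Longrightarrow> WB b x \<notin> \<real>\<^sub>\<le>\<^sub>0"
  shows "has_grad (\<lambda>x. \<Sum>(b, e, c)\<leftarrow>ts. c * prim e (WB b x))
    (\<chi> l. \<Sum>(b, e, c)\<leftarrow>ts. c * dprim e (WB b x) * WB_grad b x $ l) x"
  using assms
proof (induction ts)
  case Nil
  have "(\<chi> l. 0) = (0 :: complex ^ 'a)" by (simp add: vec_eq_iff)
  then show ?case using has_grad_const [of 0 x] by simp
next
  case (Cons t ts)
  obtain b e c where t: "t = (b, e, c)" by (cases t)
  have nz: "WB b x \<notin> \<real>\<^sub>\<le>\<^sub>0" using Cons.prems t by auto
  have "has_grad (\<lambda>x. \<Sum>(b, e, c)\<leftarrow>ts. c * prim e (WB b x))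
      (\<chi> l. \<Sum>(b, e, c)\<leftarrow>ts. c * dprim e (WB b x) * WB_grad b x $ l) x"
    using Cons by auto
  from has_grad_add [OF has_grad_mult [OF has_grad_const [of c] has_grad_compose [OF has_grad_WB prim_has_field_derivative [OF nz]]] this]
  have "has_grad (\<lambda>x. c * prim e (WB b x) + (\<Sum>(b, e, c)\<leftarrow>ts. c * prim e (WB b x)))
      (c *s (dprim e (WB b x) *s WB_grad b x) + prim e (WB b x) *s 0 +
       (\<chi> l. \<Sum>(b, e, c)\<leftarrow>ts. c * dprim e (WB b x) * WB_grad b x $ l)) x" .
  moreover have "c *s (dprim e (WB b x) *s WB_grad b x) + prim e (WB b x) *s 0 +
       (\<chi> l. \<Sum>(b, e, c)\<leftarrow>ts. c * dprim e (WB b x) * WB_grad b x $ l) =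
      (\<chi> l. \<Sum>(b, e, c)\<leftarrow>t # ts. c * dprim e (WB b x) * WB_grad b x $ l)"
    by (simp add: vec_eq_iff t)
  ultimately show ?case by (simp add: t)
qed

text \<open>Differentiating the identity between functions shows that the components sum to zero;
  each is closed because it has the form f(u) du and second derivatives of u are symmetric.\<close>

lemma abelian_relation_of_terms:
  fixes U :: "(complex ^ 'n::{finite,linorder}) set"
  assumes U: "open U" and nonpos: "\<And>x a. x \<in> U \<Longrightarrow> a \<in> WB_index \<Longrightarrow> WB a x \<notin> \<real>\<^sub>\<le>\<^sub>0"
    and ts: "\<And>b e c. (b, e, c) \<in> set ts \<Longrightarrow> b \<in> WB_index"
    and rel: "\<And>x. x \<in> U \<Longrightarrow> (\<Sum>(b, e, c)\<leftarrow>ts. c * prim e (WB b x)) = 0"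
  shows "abelian_relation WB_index WB U (\<lambda>a x. rel_deriv ts a (WB a x) *s WB_grad a x)"
proof -
  have grad: "\<exists>H. (\<forall>k. has_grad (\<lambda>y. (rel_deriv ts a (WB a y) *s WB_grad a y) $ k) (H k) x) \<and>
      (\<forall>k l. H k $ l = H l $ k)" if xa: "x \<in> U" "a \<in> WB_index" for x a
  proof -
    obtain D where D: "(rel_deriv ts a has_field_derivative D) (at (WB a x))"
      using rel_deriv_has_field_derivative [OF nonpos [OF xa]] by blast
    obtain H where H: "\<And>k. has_grad (\<lambda>y. WB_grad a y $ k) (H k) x" "\<And>k l. H k $ l = H l $ k"
      using WB_grad_symmetric by blast
    have "has_grad (\<lambda>y. (rel_deriv ts a (WB a y) *s WB_grad a y) $ k)
        (rel_deriv ts a (WB a x) *s H k + WB_grad a x $ k *s (D *s WB_grad a x)) x" for k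
      using has_grad_mult [OF has_grad_compose [OF has_grad_WB D] H(1)] by simp
    then show ?thesis
      using H(2) by (intro exI [of _ "\<lambda>k. rel_deriv ts a (WB a x) *s H k + WB_grad a x $ k *s (D *s WB_grad a x)"]) auto
  qed
  show ?thesis
    unfolding abelian_relation_def
  proof (intro conjI ballI allI)
    fix a :: "'n wb_index" and l :: 'n assume "a \<in> WB_index"
    then show "holo_on (\<lambda>x. (rel_deriv ts a (WB a x) *s WB_grad a x) $ l) U"
      unfolding holo_on_iff_has_grad using grad by blast
  next
    fix a :: "'n wb_index" and x k l assume a: "a \<in> WB_index" "x \<in> U"
    obtain H where H: "\<And>k. has_grad (\<lambda>y. (rel_deriv ts a (WB a y) *s WB_grad a y) $ k) (H k) x"
      "\<And>k l. H k $ l = H l $ k" using grad [OF a(2,1)] by blast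
    show "partial (\<lambda>y. (rel_deriv ts a (WB a y) *s WB_grad a y) $ k) l x =
        partial (\<lambda>y. (rel_deriv ts a (WB a y) *s WB_grad a y) $ l) k x"
      unfolding has_grad_partial [OF H(1)] by (rule H(2))
  next
    fix a :: "'n wb_index" and x
    show "form_ker (differential (WB a) x) \<subseteq> form_ker (rel_deriv ts a (WB a x) *s WB_grad a x)"
      by (auto simp: form_ker_def differential_WB mult.assoc sum_distrib_left [symmetric])
  next
    fix x assume x: "x \<in> U"
    have "has_grad (\<lambda>_. 0) (\<chi> l. \<Sum>(b, e, c)\<leftarrow>ts. c * dprim e (WB b x) * WB_grad b x $ l) x"
      using ts nonpos [OF x] by (intro has_grad_transform [OF has_grad_rel U x]) (auto simp: rel)
    then have "(\<Sum>(b, e, c)\<leftarrow>ts. c * dprim e (WB b x) * WB_grad b x $ l) = 0" for l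
      using has_grad_partial [OF has_grad_const [of 0 x], of l] has_grad_partial [of "\<lambda>_. 0" _ x l] by force
    then show "(\<Sum>a\<in>WB_index. rel_deriv ts a (WB a x) *s WB_grad a x) = 0"
      using sum_rel_deriv [OF finite_WB_index ts] by (simp add: vec_eq_iff sum_component)
  qed
qed

section \<open>Independence of the germs at the base point\<close>

fun WB_degree :: "'n wb_index \<Rightarrow> nat" where
  "WB_degree (Coord i) = 1"
| "WB_degree (Add2 i j) = 1"
| "WB_degree (Diff2 i j) = 1"
| "WB_degree (Mult2 i j) = 2"
| "WB_degree (Add3 i j k) = 1"
| "WB_degree (Squares3 i j k) = 2"
| "WB_degree (Mult3 i j k) = 3"
| "WB_degree (Mult4 i j k m) = 4"

lemma WB_homogeneous: "WB a (c *s x) = c ^ WB_degree a * WB a x"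
  by (cases a) (simp_all add: algebra_simps eval_nat_numeral)

lemma WB_degree_pos: "WB_degree a > 0"
  by (cases a) auto

text \<open>At the base point every function of the web is a positive real, hence away from the cut
  of the logarithm.\<close>

lemma Re_WB_point_pos:
  fixes a :: "'n::{finite,linorder} wb_index"
  assumes "a \<in> WB_index"
  shows "Re (WB a WB_point) > 0"
proof -
  define M :: "'n \<Rightarrow> real" where "M i = real (Suc (card {j. j < i}))" for i
  have M: "WB_point $ i = complex_of_real (M i)" for i by (simp add: WB_point_def M_def)
  have pos: "M i > 0" for i by (simp add: M_def)
  have less: "M i < M j" if "i < j" for i j using WB_point_less [OF that] by (simp add: M_def)
  show ?thesis
    using assms
    by (cases a) (auto simp: M WB_index_def less power2_eq_square pos add_pos_pos)
qed

lemma eventually_near_WB_point: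
  "\<forall>\<^sub>F x in nhds (WB_point :: complex ^ 'n::{finite,linorder}). x \<in> WB_locus \<and> (\<forall>a\<in>WB_index. WB a x \<notin> \<real>\<^sub>\<le>\<^sub>0) \<and>
     (\<forall>i. \<bar>Im (Ln (x $ i))\<bar> < pi / 4)"
proof (intro eventually_conj eventually_ball_finite finite_WB_index ballI eventually_all_finite)
  let ?p = "WB_point :: (complex, 'n) vec"
  show "\<forall>\<^sub>F x in nhds ?p. x \<in> WB_locus"
    by (rule eventually_nhds_in_open [OF open_WB_locus WB_point_in_locus])
  show "\<forall>\<^sub>F x in nhds ?p. WB a x \<notin> \<real>\<^sub>\<le>\<^sub>0" if a: "a \<in> WB_index" for a
  proof -
    have "(WB a \<longlongrightarrow> WB a ?p) (nhds ?p)"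
      using has_grad_imp_isCont [OF has_grad_WB [of a ?p]] unfolding isCont_def tendsto_at_iff_tendsto_nhds .
    from topological_tendstoD [OF this, of "- \<real>\<^sub>\<le>\<^sub>0"] show ?thesis
      using Re_WB_point_pos [OF a] by (simp add: open_Compl complex_nonpos_Reals_iff)
  qed
  show "\<forall>\<^sub>F x in nhds ?p. \<bar>Im (Ln (x $ i))\<bar> < pi / 4" for i
  proof -
    have p: "?p $ i = complex_of_real (real (Suc (card {j. j < i})))" by (simp add: WB_point_def)
    then have np: "?p $ i \<notin> \<real>\<^sub>\<le>\<^sub>0" by (simp add: complex_nonpos_Reals_iff)
    have "isCont (\<lambda>x. Ln (x $ i)) ?p"
      by (rule has_grad_imp_isCont [OF has_grad_compose [OF has_grad_nth has_field_derivative_Ln [OF np]]])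
    then have "((\<lambda>x. Ln (x $ i)) \<longlongrightarrow> Ln (?p $ i)) (nhds ?p)"
      by (simp only: isCont_def tendsto_at_iff_tendsto_nhds [of "\<lambda>x. Ln (x $ i)"])
    moreover have "open {z. \<bar>Im z\<bar> < pi / 4}" by (intro open_Collect_less continuous_intros)
    moreover have "Im (Ln (?p $ i)) = 0"
      unfolding p by (subst Ln_of_real) simp_all
    ultimately show ?thesis
      using topological_tendstoD [of _ "Ln (?p $ i)" "nhds ?p" "{z. \<bar>Im z\<bar> < pi / 4}"] by force
  qed
qed

text \<open>The reduced echelon form at work: the matrix of coefficients at the leads is the
  identity.\<close>

lemma rel_coeff_wb_rest:
  fixes a b :: "'n::{finite,linorder} wb_index"
  assumes "a \<in> WB_index" "e \<in> wb_leads a" "b \<in> WB_index" "e' \<in> wb_leads b"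
  shows "rel_coeff ((b, e', 1) # wb_rest b e') a e = (if (b, e') = (a, e) then 1 else 0)"
proof -
  have "(\<forall>c. (a, e, c) \<notin> set ts) \<longrightarrow> rel_coeff ts a e = 0" for ts :: "('n wb_index \<times> wb_prim \<times> complex) list"
    unfolding rel_coeff_def by (induction ts) (auto split: if_splits)
  moreover have "(a, e, c) \<notin> set (wb_rest b e')" for c
    using wb_rest_terms [OF assms(3,4)] assms(2) by blast
  ultimately show ?thesis by (auto simp: rel_coeff_def)
qed

text \<open>Relations are numbered by their leads (a, e). To see that one coefficient of a vanishing
  combination is zero, only the component at its own \<open>a\<close> is used: it is a function of
  one variable, and its coefficient at e is exactly the one sought.\<close>

lemma abelian_dim_WB_point_ge:
  assumes n: "CARD('n::{finite,linorder}) \<ge> 2"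
  shows "abelian_dim WB_index WB (WB_point :: (complex, 'n) vec) \<ge> enat (pi' CARD('n) (cdim CARD('n) 4))"
proof -
  let ?I = "WB_index :: 'n wb_index set" and ?p = "WB_point :: (complex, 'n) vec"
  define R where "R = Sigma ?I wb_leads"
  define K where "K = pi' CARD('n) (cdim CARD('n) 4)"
  define ts where "ts r = (fst r, snd r, 1) # wb_rest (fst r) (snd r)" for r :: "'n wb_index \<times> wb_prim"
  have "finite (wb_leads a)" for a :: "'n wb_index" by (cases a) auto
  then have "finite R" unfolding R_def using finite_WB_index [where 'n='n] by auto
  then obtain r where r: "bij_betw r {0..<K} R"
    using ex_bij_betw_nat_finite [of R] card_WB_leads [OF n] unfolding R_def K_def by auto
  have rR: "fst (r j) \<in> ?I" "snd (r j) \<in> wb_leads (fst (r j))" if "j < K" for j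
    using bij_betwE [OF r] that unfolding R_def by force+
  define \<omega> where "\<omega> j a x = rel_deriv (ts (r j)) a (WB a x) *s WB_grad a x" for j a x
  have tsI: "b \<in> ?I" "e \<in> Power ` {1..6} \<union> LogPower ` {1..6}" if "j < K" "(b, e, c) \<in> set (ts (r j))" for j b e c
    using that(2) wb_rest_terms [OF rR [OF that(1)], of b e c] rR [OF that(1)] wb_leads_range [OF rR(2) [OF that(1)]]
    unfolding ts_def by auto
  obtain d where d: "d > 0" "\<And>x. dist x ?p < d \<Longrightarrow> x \<in> WB_locus \<and> (\<forall>a\<in>?I. WB a x \<notin> \<real>\<^sub>\<le>\<^sub>0) \<and>
     (\<forall>i. \<bar>Im (Ln (x $ i))\<bar> < pi / 4)"
    using eventually_near_WB_point [where 'n='n] unfolding eventually_nhds_metric by blast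
  define U where "U = ball ?p d"
  have U: "x \<in> WB_locus" "\<forall>a\<in>?I. WB a x \<notin> \<real>\<^sub>\<le>\<^sub>0" "\<forall>i. \<bar>Im (Ln (x $ i))\<bar> < pi / 4" if "x \<in> U" for x
    using d(2) [of x] that by (auto simp: U_def dist_commute)
  have germ: "abelian_germ ?I WB ?p (\<omega> j)" if j: "j < K" for j
    unfolding abelian_germ_def
  proof (intro exI [of _ U] conjI)
    show "open U" "connected U" "?p \<in> U" by (simp_all add: U_def d(1))
    show "simply_connected U" unfolding U_def by (intro convex_imp_simply_connected convex_ball)
    show "U \<subseteq> regular_locus ?I WB" unfolding regular_locus_WB [OF n] using U(1) by blast
    show "abelian_relation ?I WB U (\<omega> j)"
      unfolding \<omega>_def [abs_def]
    proof (rule abelian_relation_of_terms [OF \<open>open U\<close>])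
      fix x assume x: "x \<in> U"
      have "x $ i \<noteq> 0" for i using U(1) [OF x] by (simp add: WB_locus_def)
      from WB_relation [OF this, of "fst (r j)" "snd (r j)"] U(3) [OF x] rR [OF j]
      show "(\<Sum>(b, e, c)\<leftarrow>ts (r j). c * prim e (WB b x)) = 0" unfolding ts_def by blast
    qed (use U(2) tsI(1) [OF j] in blast)+
  qed
  have ind: "independent_germs ?I ?p K \<omega>"
    unfolding independent_germs_def
  proof (intro allI impI)
    fix c :: "nat \<Rightarrow> complex" and j0
    assume c: "\<forall>\<^sub>F x in nhds ?p. \<forall>a\<in>?I. (\<Sum>j<K. c j *s \<omega> j a x) = 0" and j0: "j0 < K"
    define a where "a = fst (r j0)"
    define e0 where "e0 = snd (r j0)"
    have a: "a \<in> ?I" and e0: "e0 \<in> wb_leads a" using rR [OF j0] by (simp_all add: a_def e0_def)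
    let ?s0 = "WB a ?p" and ?D = "WB_degree a"
    define E where "E = Power ` {1..6} \<union> LogPower ` {1..6::nat}"
    \<comment> \<open>Coefficient of \<open>dprim e\<close> in the component at \<open>a\<close> of
      the whole combination.\<close>
    define \<kappa> where "\<kappa> e = (\<Sum>j<K. c j * rel_coeff (ts (r j)) a e)" for e
    have s0: "?s0 \<notin> \<real>\<^sub>\<le>\<^sub>0" using Re_WB_point_pos [OF a] by (simp add: complex_nonpos_Reals_iff)
    then have s0': "?s0 \<noteq> 0" by auto
    have E: "(\<Sum>j<K. c j * rel_deriv (ts (r j)) a s) = (\<Sum>e\<in>E. \<kappa> e * dprim e s)" for s
    proof -
      have "(\<Sum>j<K. c j * rel_deriv (ts (r j)) a s) = (\<Sum>j<K. \<Sum>e\<in>E. c j * (rel_coeff (ts (r j)) a e * dprim e s))"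
      proof (rule sum.cong [OF refl])
        fix j assume "j \<in> {..<K}"
        then have "rel_deriv (ts (r j)) a s = (\<Sum>e\<in>E. rel_coeff (ts (r j)) a e * dprim e s)"
          using tsI(2) [of j] by (intro rel_deriv_conv_coeff) (auto simp: E_def)
        then show "c j * rel_deriv (ts (r j)) a s = (\<Sum>e\<in>E. c j * (rel_coeff (ts (r j)) a e * dprim e s))"
          by (simp only: sum_distrib_left)
      qed
      also have "\<dots> = (\<Sum>e\<in>E. \<Sum>j<K. c j * (rel_coeff (ts (r j)) a e * dprim e s))" by (rule sum.swap)
      also have "\<dots> = (\<Sum>e\<in>E. \<kappa> e * dprim e s)" by (simp add: \<kappa>_def sum_distrib_right mult.assoc)
      finally show ?thesis .
    qed
    have "\<forall>\<^sub>F x in nhds ?p. x \<in> U" unfolding U_def by (rule eventually_nhds_in_open) (simp_all add: d(1))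
    with c have "\<forall>\<^sub>F x in nhds ?p. (\<Sum>j<K. c j * rel_deriv (ts (r j)) a (WB a x)) = 0"
    proof eventually_elim
      case (elim x)
      obtain q where q: "WB_grad a x $ q \<noteq> 0" using WB_grad_nonzero [OF U(1) [OF elim(2)] a] .
      have "(\<Sum>j<K. c j *s \<omega> j a x) $ q = 0" using elim(1) a by simp
      then have "(\<Sum>j<K. c j * rel_deriv (ts (r j)) a (WB a x)) * WB_grad a x $ q = 0"
        by (simp add: \<omega>_def sum_component sum_distrib_right mult.assoc)
      then show ?case using q by simp
    qed
    then have ev: "\<forall>\<^sub>F x in nhds ?p. (\<Sum>e\<in>E. \<kappa> e * dprim e (WB a x)) = 0" unfolding E .
    \<comment> \<open>Moving along the ray through the base point, the homogeneous function takes all values near \<open>?s0\<close>.\<close>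
    define \<rho> where "\<rho> s = exp ((Ln s - Ln ?s0) / of_nat ?D)" for s
    have "isCont (\<lambda>s. \<rho> s *s ?p) ?s0"
    proof -
      have "isCont \<rho> ?s0" unfolding \<rho>_def using s0
        by (intro continuous_intros) (auto simp: WB_degree_pos)
      then show ?thesis by (rule bounded_linear.isCont [OF bounded_linear_vector_smult])
    qed
    then have "filterlim (\<lambda>s. \<rho> s *s ?p) (nhds (\<rho> ?s0 *s ?p)) (nhds ?s0)"
      by (simp only: isCont_def tendsto_at_iff_tendsto_nhds [of "\<lambda>s. \<rho> s *s ?p"])
    then have "filterlim (\<lambda>s. \<rho> s *s ?p) (nhds ?p) (nhds ?s0)" by (simp add: \<rho>_def)
    with ev have "\<forall>\<^sub>F s in nhds ?s0. (\<Sum>e\<in>E. \<kappa> e * dprim e (WB a (\<rho> s *s ?p))) = 0"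
      unfolding filterlim_iff by blast
    moreover have "\<forall>\<^sub>F s in nhds ?s0. s \<noteq> 0"
      using s0' by (intro t1_space_nhds)
    ultimately have "\<forall>\<^sub>F s in nhds ?s0. (\<Sum>e\<in>E. \<kappa> e * dprim e s) = 0"
    proof eventually_elim
      case (elim s)
      have "\<rho> s ^ ?D = exp (Ln s - Ln ?s0)"
        unfolding \<rho>_def exp_of_nat_mult [symmetric] using WB_degree_pos [of a] by simp
      also have "\<dots> = s / ?s0" using elim(2) s0' by (simp add: exp_diff)
      finally have "WB a (\<rho> s *s ?p) = s" unfolding WB_homogeneous using s0' by simp
      then show ?case using elim(1) by simp
    qed
    moreover have "(\<Sum>e\<in>E. \<kappa> e * dprim e s) =
        (\<Sum>k = 1..6. \<kappa> (Power k) * dprim (Power k) s) + (\<Sum>k = 1..6. \<kappa> (LogPower k) * dprim (LogPower k) s)" for s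
      unfolding E_def by (subst sum.union_disjoint) (auto simp: sum.reindex inj_on_def)
    ultimately have "\<kappa> (Power k) = 0 \<and> \<kappa> (LogPower k) = 0" if "k \<in> {1..6}" for k
      using dprim_independent [where N = 6 and \<alpha> = "\<lambda>k. \<kappa> (Power k)" and \<beta> = "\<lambda>k. \<kappa> (LogPower k)" and k = k, OF s0]
        that by simp
    then have "\<kappa> e0 = 0" using wb_leads_range [OF e0] by auto
    moreover have "\<kappa> e0 = (\<Sum>j<K. if j = j0 then c j else 0)"
      unfolding \<kappa>_def
    proof (rule sum.cong [OF refl])
      fix j assume "j \<in> {..<K}"
      then have j: "j < K" by simp
      have "(fst (r j), snd (r j)) = (a, e0) \<longleftrightarrow> j = j0"
        using bij_betw_imp_inj_on [OF r] j j0 by (auto simp: a_def e0_def inj_on_eq_iff prod_eq_iff [symmetric])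
      then show "c j * rel_coeff (ts (r j)) a e0 = (if j = j0 then c j else 0)"
        unfolding ts_def rel_coeff_wb_rest [OF a e0 rR [OF j]] by simp
    qed
    ultimately show "c j0 = 0" using j0 by simp
  qed
  have "enat K \<le> abelian_dim ?I WB ?p"
    unfolding abelian_dim_def by (rule Sup_upper) (use germ ind in blast)
  then show ?thesis by (simp only: K_def)
qed

theorem mainTheorem1:
  assumes "CARD('n::{finite,linorder}) \<ge> 2"
  shows "is_web (cdim CARD('n) 4) (WB_index :: 'n wb_index set) WB \<and>
         ordinary (WB_index :: 'n wb_index set) WB \<and>
         web_rank (WB_index :: 'n wb_index set) WB = enat (pi' CARD('n) (cdim CARD('n) 4))"
proof (intro conjI)
  show "is_web (cdim CARD('n) 4) (WB_index :: 'n wb_index set) WB" by (rule is_web_WB [OF assms])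
  show "ordinary (WB_index :: 'n wb_index set) WB" by (rule ordinary_WB [OF assms])
  show "web_rank (WB_index :: 'n wb_index set) WB = enat (pi' CARD('n) (cdim CARD('n) 4))"
    unfolding web_rank_def regular_locus_WB [OF assms]
  proof (rule antisym)
    show "(SUP m\<in>WB_locus. abelian_dim (WB_index :: 'n wb_index set) WB m) \<le> enat (pi' CARD('n) (cdim CARD('n) 4))"
      using abelian_dim_WB_le [OF assms] by (rule SUP_least)
    show "enat (pi' CARD('n) (cdim CARD('n) 4)) \<le> (SUP m\<in>WB_locus. abelian_dim (WB_index :: 'n wb_index set) WB m)"
      by (rule order_trans [OF abelian_dim_WB_point_ge [OF assms]]) (rule SUP_upper [OF WB_point_in_locus])
  qed
qed

end
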